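(* Let $m:\widehat\Gamma\to\{0,1,2,\ldots,\infty\}$ be a Borel map, let $H$ be a filter relative to $m$ and $\alpha^*$, and let $S_H$ be the associated Ruelle operator. Assume that $m$ is finite on a set of positive Haar measure. If $S_H$ is an isometry on $\bigoplus_j L^2(\sigma_j,\mu)$, then $S_H$ fails to be a pure isometry if and only if it has an eigenvector; specifically, $S_H$ fails to be a pure isometry if and only if there exist a nonzero element $f\in\bigoplus_j L^2(\sigma_j,\mu)$ and a scalar $\lambda$ with $|\lambda|=1$ such that $S_H(f)=\lambda f$. Moreover, if $f$ is a unit eigenvector for $S_H$, then $\|f(\omega)\|=1$ for almost every $\omega\in\widehat\Gamma$.
   Context: Setting. $\Gamma$ is a countable (discrete) abelian group, written additively, with compact dual group $\widehat\Gamma$, written multiplicatively and equipped with Haar measure $\mu$ of total mass 1 (integrals $d\omega$ and "almost every" refer to $\mu$). $\alpha:\Gamma\to\Gamma$ is an injective homomorphism such that the index of $\alpha(\Gamma)$ in $\Gamma$ is a finite number $N>1$ and $\bigcap_{n\ge 0}\alpha^n(\Gamma)=\{0\}$. $\alpha^*:\widehat\Gamma\to\widehat\Gamma$ is the dual endomorphism, $[\alpha^*(\omega)](\gamma)=\omega(\alpha(\gamma))$; it is surjective with kernel of exactly $N$ elements. For a Borel map $m:\widehat\Gamma\to\{0,1,2,\ldots,\infty\}$ and $i\ge 1$ put $\sigma_i=\{\omega\in\widehat\Gamma: m(\omega)\ge i\}$, so $m=\sum_i\chi_{\sigma_i}$. Filter: a (possibly infinite) matrix $H=[h_{i,j}]$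 of Borel complex-valued functions on $\widehat\Gamma$ is a filter relative to $m$ and $\alpha^*$ if for every $j$ the function $h_{i,j}$ is supported in $\sigma_j$, and for all $i,i'$ $$\sum_{\alpha^*(\zeta)=1}\sum_j h_{i,j}(\omega\zeta)\overline{h_{i',j}(\omega\zeta)}=N\delta_{i,i'}\chi_{\sigma_i}(\alpha^*(\omega))$$ for almost all $\omega\in\widehat\Gamma$. Ruelle operator: $[S_H(f)](\omega)=H^t(\omega)f(\alpha^*(\omega))=\bigoplus_j\sum_i h_{i,j}(\omega)f_i(\alpha^*(\omega))$ for $f=\bigoplus_i f_i\in\bigoplus_i L^2(\sigma_i,\mu)$ (functions on $\sigma_i$ being extended by $0$ to $\widehat\Gamma$); $S_H$ is called the Ruelle operator associated to $H$ when this formula defines a bounded operator of $\bigoplus_i L^2(\sigma_i,\mu)$ into itself, which is assumed throughout. For $f=\bigoplus_i f_i$, $\|f(\omega)\|=\left(\sum_i|f_i(\omega)|^2\right)^{1/2}$. An isometry $S$ of a Hilbert space into itself is a pure isometry if $\bigcap_{n\ge1}\operatorname{Range}(S^n)=\{0\}$. *)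

theory Defs
  imports "HOL-Analysis.Analysis" "HOL-Library.Function_Algebras"
begin

text \<open>
  The group \<open>\<Gamma>\<close> is a type of class \<open>{ab_group_add, countable}\<close> with the discrete topology. Its dual is
  a subset of the function space, so the topology of pointwise convergence (for discrete \<open>\<Gamma>\<close>, the
  compact-open topology), the pointwise product and the unit character \<open>1\<close> are those of the
  function type.
\<close>

definition dual_group :: "('g::ab_group_add \<Rightarrow> complex) set" where
  "dual_group = {\<omega>. (\<forall>x. cmod (\<omega> x) = 1) \<and> (\<forall>x y. \<omega> (x + y) = \<omega> x * \<omega> y)}"

definition normalized_haar :: "('g::{ab_group_add, countable} \<Rightarrow> complex) measure \<Rightarrow> bool" where
  "normalized_haar \<mu> \<longleftrightarrow>
     sets \<mu> = sets (restrict_space borel dual_group) \<and>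
     emeasure \<mu> (space \<mu>) = 1 \<and>
     (\<forall>\<eta>\<in>dual_group. \<forall>A\<in>sets \<mu>. emeasure \<mu> ((*) \<eta> ` A) = emeasure \<mu> A)"

text \<open>The number of cosets; it is \<open>0\<close> if there are infinitely many.\<close>

definition range_index :: "('g::ab_group_add \<Rightarrow> 'g) \<Rightarrow> nat" where
  "range_index \<alpha> = card (range (\<lambda>g. (+) g ` range \<alpha>))"

definition dual_map :: "('g \<Rightarrow> 'g) \<Rightarrow> ('g \<Rightarrow> complex) \<Rightarrow> ('g \<Rightarrow> complex)" where
  "dual_map \<alpha> \<omega> = (\<lambda>x. \<omega> (\<alpha> x))"

definition level_set :: "(('g::ab_group_add \<Rightarrow> complex) \<Rightarrow> enat) \<Rightarrow> nat \<Rightarrow> ('g \<Rightarrow> complex) set" where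
  "level_set m i = {\<omega> \<in> dual_group. enat i \<le> m \<omega>}"

text \<open>
  Matrices and direct sums are indexed by all \<open>i \<ge> 1\<close>; a finite matrix is padded with zeros (the
  corresponding level sets are empty). The inner series is required to
  converge explicitly because \<open>infsum\<close> is \<open>0\<close> on families that are not summable.
\<close>

definition is_matrix_filter ::
  "('g::{ab_group_add, countable} \<Rightarrow> complex) measure \<Rightarrow> ('g \<Rightarrow> 'g) \<Rightarrow> (('g \<Rightarrow> complex) \<Rightarrow> enat) \<Rightarrow>
   (nat \<Rightarrow> nat \<Rightarrow> ('g \<Rightarrow> complex) \<Rightarrow> complex) \<Rightarrow> bool" where
  "is_matrix_filter \<mu> \<alpha> m H \<longleftrightarrow>
     (\<forall>i\<in>{1..}. \<forall>j\<in>{1..}. H i j \<in> borel_measurable \<mu> \<and>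
        (\<forall>\<omega>\<in>dual_group - level_set m j. H i j \<omega> = 0)) \<and>
     (\<forall>i\<in>{1..}. \<forall>i'\<in>{1..}. AE \<omega> in \<mu>.
        (\<forall>\<zeta>\<in>{\<zeta>\<in>dual_group. dual_map \<alpha> \<zeta> = 1}.
           (\<lambda>j. H i j (\<omega> * \<zeta>) * cnj (H i' j (\<omega> * \<zeta>))) summable_on {1..}) \<and>
        (\<Sum>\<zeta>\<in>{\<zeta>\<in>dual_group. dual_map \<alpha> \<zeta> = 1}.
           \<Sum>\<^sub>\<infinity>j\<in>{1..}. H i j (\<omega> * \<zeta>) * cnj (H i' j (\<omega> * \<zeta>))) =
        of_nat (range_index \<alpha>) * (if i = i' then 1 else 0) *
          indicator (level_set m i) (dual_map \<alpha> \<omega>))"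

text \<open>
  The Hilbert space \<open>\<Oplus>\<^sub>i L\<^sup>2(\<sigma>\<^sub>i, \<mu>)\<close> is represented by families of square integrable Borel
  functions, extended by zero off \<open>\<sigma>\<^sub>i\<close>; two families denote the same vector iff they are
  related by \<open>L2_eq\<close>. The component with index \<open>0\<close> plays no role.
\<close>

definition L2_sum ::
  "('g::{ab_group_add, countable} \<Rightarrow> complex) measure \<Rightarrow> (('g \<Rightarrow> complex) \<Rightarrow> enat) \<Rightarrow>
   (nat \<Rightarrow> ('g \<Rightarrow> complex) \<Rightarrow> complex) set" where
  "L2_sum \<mu> m = {f.
     (\<forall>i\<in>{1..}. f i \<in> borel_measurable \<mu> \<and>
        (\<forall>\<omega>\<in>dual_group - level_set m i. f i \<omega> = 0) \<and>
        integrable \<mu> (\<lambda>\<omega>. (cmod (f i \<omega>))\<^sup>2)) \<and>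
     (\<lambda>i. \<integral>\<omega>. (cmod (f i \<omega>))\<^sup>2 \<partial>\<mu>) summable_on {1..}}"

definition L2_norm ::
  "('g \<Rightarrow> complex) measure \<Rightarrow> (nat \<Rightarrow> ('g \<Rightarrow> complex) \<Rightarrow> complex) \<Rightarrow> real" where
  "L2_norm \<mu> f = sqrt (\<Sum>\<^sub>\<infinity>i\<in>{1..}. \<integral>\<omega>. (cmod (f i \<omega>))\<^sup>2 \<partial>\<mu>)"

definition L2_eq ::
  "('g \<Rightarrow> complex) measure \<Rightarrow> (nat \<Rightarrow> ('g \<Rightarrow> complex) \<Rightarrow> complex) \<Rightarrow>
   (nat \<Rightarrow> ('g \<Rightarrow> complex) \<Rightarrow> complex) \<Rightarrow> bool" where
  "L2_eq \<mu> f g \<longleftrightarrow> (\<forall>i\<in>{1..}. AE \<omega> in \<mu>. f i \<omega> = g i \<omega>)"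

definition fibre_norm ::
  "(nat \<Rightarrow> ('g \<Rightarrow> complex) \<Rightarrow> complex) \<Rightarrow> ('g \<Rightarrow> complex) \<Rightarrow> real" where
  "fibre_norm f \<omega> = sqrt (\<Sum>\<^sub>\<infinity>i\<in>{1..}. (cmod (f i \<omega>))\<^sup>2)"

definition ruelle ::
  "('g \<Rightarrow> 'g) \<Rightarrow> (nat \<Rightarrow> nat \<Rightarrow> ('g \<Rightarrow> complex) \<Rightarrow> complex) \<Rightarrow>
   (nat \<Rightarrow> ('g \<Rightarrow> complex) \<Rightarrow> complex) \<Rightarrow> (nat \<Rightarrow> ('g \<Rightarrow> complex) \<Rightarrow> complex)" where
  "ruelle \<alpha> H f = (\<lambda>j \<omega>. \<Sum>\<^sub>\<infinity>i\<in>{1..}. H i j \<omega> * f i (dual_map \<alpha> \<omega>))"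

definition is_ruelle_operator ::
  "('g::{ab_group_add, countable} \<Rightarrow> complex) measure \<Rightarrow> ('g \<Rightarrow> 'g) \<Rightarrow> (('g \<Rightarrow> complex) \<Rightarrow> enat) \<Rightarrow>
   (nat \<Rightarrow> nat \<Rightarrow> ('g \<Rightarrow> complex) \<Rightarrow> complex) \<Rightarrow> bool" where
  "is_ruelle_operator \<mu> \<alpha> m H \<longleftrightarrow>
     (\<forall>f\<in>L2_sum \<mu> m. \<forall>j\<in>{1..}. AE \<omega> in \<mu>.
        (\<lambda>i. H i j \<omega> * f i (dual_map \<alpha> \<omega>)) summable_on {1..}) \<and>
     (\<forall>f\<in>L2_sum \<mu> m. ruelle \<alpha> H f \<in> L2_sum \<mu> m) \<and>
     (\<exists>C. \<forall>f\<in>L2_sum \<mu> m. L2_norm \<mu> (ruelle \<alpha> H f) \<le> C * L2_norm \<mu> f)"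

definition L2_isometry ::
  "('g::{ab_group_add, countable} \<Rightarrow> complex) measure \<Rightarrow> (('g \<Rightarrow> complex) \<Rightarrow> enat) \<Rightarrow>
   ((nat \<Rightarrow> ('g \<Rightarrow> complex) \<Rightarrow> complex) \<Rightarrow> (nat \<Rightarrow> ('g \<Rightarrow> complex) \<Rightarrow> complex)) \<Rightarrow> bool" where
  "L2_isometry \<mu> m S \<longleftrightarrow> (\<forall>f\<in>L2_sum \<mu> m. S f \<in> L2_sum \<mu> m \<and> L2_norm \<mu> (S f) = L2_norm \<mu> f)"

definition L2_range ::
  "('g::{ab_group_add, countable} \<Rightarrow> complex) measure \<Rightarrow> (('g \<Rightarrow> complex) \<Rightarrow> enat) \<Rightarrow>
   ((nat \<Rightarrow> ('g \<Rightarrow> complex) \<Rightarrow> complex) \<Rightarrow> (nat \<Rightarrow> ('g \<Rightarrow> complex) \<Rightarrow> complex)) \<Rightarrow>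
   (nat \<Rightarrow> ('g \<Rightarrow> complex) \<Rightarrow> complex) set" where
  "L2_range \<mu> m S = {g \<in> L2_sum \<mu> m. \<exists>f\<in>L2_sum \<mu> m. L2_eq \<mu> g (S f)}"

text \<open>The right-hand side of the equation below is the set of all representatives of \<open>0\<close>.\<close>

definition pure_L2_isometry ::
  "('g::{ab_group_add, countable} \<Rightarrow> complex) measure \<Rightarrow> (('g \<Rightarrow> complex) \<Rightarrow> enat) \<Rightarrow>
   ((nat \<Rightarrow> ('g \<Rightarrow> complex) \<Rightarrow> complex) \<Rightarrow> (nat \<Rightarrow> ('g \<Rightarrow> complex) \<Rightarrow> complex)) \<Rightarrow> bool" where
  "pure_L2_isometry \<mu> m S \<longleftrightarrow> L2_isometry \<mu> m S \<and>
     (\<Inter>n\<in>{1..}. L2_range \<mu> m (S ^^ n)) = {f \<in> L2_sum \<mu> m. L2_eq \<mu> f 0}"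

definition L2_eigenvector ::
  "('g::{ab_group_add, countable} \<Rightarrow> complex) measure \<Rightarrow> (('g \<Rightarrow> complex) \<Rightarrow> enat) \<Rightarrow>
   ((nat \<Rightarrow> ('g \<Rightarrow> complex) \<Rightarrow> complex) \<Rightarrow> (nat \<Rightarrow> ('g \<Rightarrow> complex) \<Rightarrow> complex)) \<Rightarrow>
   complex \<Rightarrow> (nat \<Rightarrow> ('g \<Rightarrow> complex) \<Rightarrow> complex) \<Rightarrow> bool" where
  "L2_eigenvector \<mu> m S c f \<longleftrightarrow>
     f \<in> L2_sum \<mu> m \<and> \<not> L2_eq \<mu> f 0 \<and> L2_eq \<mu> (S f) (\<lambda>i \<omega>. c * f i \<omega>)"

end

theory Submission
  imports Defs "HOL-Computational_Algebra.Fundamental_Theorem_Algebra"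
begin

text \<open>
  Since \<open>S\<close> intertwines multiplication by \<open>\<chi>\<^sub>A\<close> with multiplication by \<open>\<chi>\<^sub>A \<circ> \<alpha>\<^sup>*\<close>, being an isometry
  forces the fibre norms of \<open>f = S\<^sup>n f\<^sub>n\<close> to satisfy \<open>\<integral> \<parallel>f\<parallel>\<^sup>2 (\<chi>\<^sub>A \<circ> \<alpha>\<^sup>*\<^sup>n) = \<integral> \<parallel>f\<^sub>n\<parallel>\<^sup>2 \<chi>\<^sub>A\<close>. As
  \<open>\<Inter>\<^sub>n \<alpha>\<^sup>n(\<Gamma>) = {0}\<close>, a nontrivial character integrates to \<open>0\<close> against \<open>\<chi>\<^sub>A \<circ> \<alpha>\<^sup>*\<^sup>n\<close> for all large \<open>n\<close>,
  so by density of the trigonometric polynomials \<open>\<parallel>f\<^sub>n(\<omega>)\<parallel>\<^sup>2\<close> converges to the constant \<open>\<parallel>f\<parallel>\<^sup>2\<close> in \<open>L\<^sup>1\<close>.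
  For an eigenvector the fibre norms of the \<open>f\<^sub>n\<close> do not depend on \<open>n\<close>, hence are constant. For
  \<open>d + 1\<close> vectors in \<open>\<Inter>\<^sub>n Range(S\<^sup>n)\<close> the Gram matrices of the \<open>n\<close>-th preimages converge to the Gram
  matrix of the vectors, while on \<open>{m \<le> d}\<close> they are singular; so the vectors are linearly dependent.
  Applied to \<open>f, S f, \<dots>, S\<^sup>d f\<close> this gives a polynomial in \<open>S\<close> that annihilates \<open>f\<close>, and thus an
  eigenvector.
\<close>

section \<open>Extension of characters\<close>

text \<open>The preimages under S^n change with n, and so does the set where their squared fibre
  norms exceed the limit. Testing against fixed sets A would only give weak convergence; what is
  used is decay of correlations uniform in A, that is, exactness of the dual endomorphism. It holds
  because a character outside the range of \<alpha>^n is scaled by a translation that the n-th power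
  of the dual endomorphism does not see, whatever A is, and because uniform estimates survive L1
  limits. The L1 convergence treats one vector at a time, whereas the combination that vanishes in a
  fibre of dimension at most d depends on n and on the point. Compactness of the normalized
  coefficient vectors bridges this: finitely many combinations are controlled at a common point, and
  the vanishing one has coefficients close to those of one of them. So Gram matrices enter only
  through squared norms of combinations, without determinants. Vectors are classes modulo null sets,
  and additivity of S holds only up to \<open>L2_eq\<close>. S respects this relation because the
  dual endomorphism preserves Haar measure, which is where injectivity of \<alpha> enters.\<close>

text \<open>
  A character of a subgroup is encoded by its graph, so that chains have their union as upper bound.
\<close>

definition partial_char :: "('g::ab_group_add \<times> complex) set \<Rightarrow> bool" where
  "partial_char R \<longleftrightarrow> (0, 1) \<in> R \<and>
     (\<forall>x a. (x, a) \<in> R \<longrightarrow> cmod a = 1 \<and> (- x, inverse a) \<in> R) \<and>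
     (\<forall>x a y b. (x, a) \<in> R \<longrightarrow> (y, b) \<in> R \<longrightarrow> (x + y, a * b) \<in> R) \<and>
     (\<forall>a. (0, a) \<in> R \<longrightarrow> a = 1)"

lemma partial_charD:
  assumes "partial_char R"
  shows "(0, 1) \<in> R" "(x, a) \<in> R \<Longrightarrow> cmod a = 1" "(x, a) \<in> R \<Longrightarrow> (- x, inverse a) \<in> R"
    "(x, a) \<in> R \<Longrightarrow> (y, b) \<in> R \<Longrightarrow> (x + y, a * b) \<in> R" "(0, a) \<in> R \<Longrightarrow> a = 1"
  using assms unfolding partial_char_def by blast+

lemma partial_char_unique:
  assumes "partial_char R" "(x, a) \<in> R" "(x, b) \<in> R"
  shows "a = b"
proof -
  have "(x + - x, a * inverse b) \<in> R"
    using assms partial_charD(3,4) by blast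
  then have "a * inverse b = 1"
    using partial_charD(5)[OF assms(1)] by simp
  moreover have "b \<noteq> 0"
    using partial_charD(2)[OF assms(1,3)] by auto
  ultimately show ?thesis
    by (simp add: field_simps)
qed

definition nat_mult :: "nat \<Rightarrow> 'g::ab_group_add \<Rightarrow> 'g" where
  "nat_mult n x = ((+) x ^^ n) 0"

lemma nat_mult_0 [simp]: "nat_mult 0 x = 0"
  and nat_mult_Suc [simp]: "nat_mult (Suc n) x = x + nat_mult n x"
  by (simp_all add: nat_mult_def)

lemma nat_mult_add: "nat_mult (n + k) x = nat_mult n x + nat_mult k x"
  by (induction n) (simp_all add: add.assoc)

lemma nat_mult_mult: "nat_mult (n * k) x = nat_mult n (nat_mult k x)"
  by (induction n) (simp_all add: nat_mult_add)

lemma partial_char_nat_mult: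
  assumes "partial_char R" "(x, a) \<in> R"
  shows "(nat_mult n x, a ^ n) \<in> R"
  by (induction n) (use assms partial_charD in auto)

text \<open>For b = 1 a primitive p-th root of unity serves; for any other b no p-th root can equal
  1, so every root does.\<close>

lemma unit_root_neq_1:
  fixes b :: complex
  assumes "cmod b = 1" "p \<ge> 2"
  obtains z where "z ^ p = b" "cmod z = 1" "z \<noteq> 1"
proof (cases "b = 1")
  case True
  let ?z = "cis (2 * pi / p)"
  have "?z ^ p = 1"
    using assms(2) by (simp add: Complex.DeMoivre)
  moreover have "?z \<noteq> 1"
  proof
    assume "?z = 1"
    then have "cos (2 * pi / p) = 1"
      by (metis cis.simps(1) one_complex.simps(1))
    then obtain k :: int where k: "2 * pi / p = of_int k * 2 * pi"
      using cos_one_2pi_int by blast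
    then have "1 = of_int k * real p"
      using assms(2) by (simp add: field_simps)
    then have "1 = k * int p"
      by (metis of_int_1 of_int_eq_iff of_int_mult of_int_of_nat_eq)
    then have "int p dvd 1"
      by (metis dvd_triv_right)
    then show False
      using assms(2) by simp
  qed
  ultimately show ?thesis
    using True that[of ?z] by simp
next
  case False
  have "cis (Arg b / p) ^ p = cis (Arg b)"
    using assms(2) by (simp add: Complex.DeMoivre)
  also have "\<dots> = b"
    using assms(1) cis_Arg[of b] by (cases "b = 0") (auto simp: sgn_eq)
  finally show ?thesis
    using False that[of "cis (Arg b / p)"] by (metis norm_cis power_one)
qed

text \<open>The value z at x has to agree with R at the multiples of x already in the domain
  (\<open>zR\<close>), and this alone makes the extension well defined. Insisting on z \<noteq> 1 as
  well is what separates x from a subgroup later.\<close>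

lemma partial_char_extend_step:
  fixes R :: "('g::ab_group_add \<times> complex) set"
  assumes R: "partial_char R" and x: "x \<notin> fst ` R"
  obtains R' z where "partial_char R'" "R \<subseteq> R'" "(x, z) \<in> R'" "z \<noteq> 1"
proof -
  obtain z :: complex where z: "cmod z = 1" "z \<noteq> 1"
    and zR: "\<And>j b. (nat_mult j x, b) \<in> R \<Longrightarrow> z ^ j = b"
  proof (cases "\<exists>j>0. nat_mult j x \<in> fst ` R")
    case True
    \<comment> \<open>Every multiple of x in the domain is a multiple of p times x. As x itself is
      not in the domain, p is at least 2, which leaves a p-th root of b other than 1.\<close>
    define p where "p = (LEAST j. j > 0 \<and> nat_mult j x \<in> fst ` R)"
    have p: "p > 0 \<and> nat_mult p x \<in> fst ` R"
      unfolding p_def using True by (rule LeastI_ex)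
    have p_min: "\<not> (j > 0 \<and> nat_mult j x \<in> fst ` R)" if "j < p" for j
      using that not_less_Least unfolding p_def by blast
    obtain b where b: "(nat_mult p x, b) \<in> R"
      using p by auto
    have "p \<noteq> 1"
      using p x by (auto simp: image_iff)
    then have "p \<ge> 2"
      using p by auto
    then obtain z where z: "z ^ p = b" "cmod z = 1" "z \<noteq> 1"
      using unit_root_neq_1 partial_charD(2)[OF R b] by metis
    have "z ^ j = c" if c: "(nat_mult j x, c) \<in> R" for j c
    proof -
      have pq: "(nat_mult (j div p * p) x, b ^ (j div p)) \<in> R"
        using partial_char_nat_mult[OF R b] by (simp add: nat_mult_mult)
      have "(nat_mult j x + - nat_mult (j div p * p) x, c * inverse (b ^ (j div p))) \<in> R"
        using partial_charD(3,4)[OF R] pq c by blast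
      moreover have "nat_mult j x + - nat_mult (j div p * p) x = nat_mult (j mod p) x"
        using nat_mult_add[of "j div p * p" "j mod p" x] by simp
      ultimately have "nat_mult (j mod p) x \<in> fst ` R"
        by (metis fst_conv image_eqI)
      moreover have "j mod p < p"
        using p by simp
      ultimately have "j mod p = 0"
        using p_min[of "j mod p"] by (metis gr0I)
      then have j: "j = j div p * p"
        using div_mult_mod_eq[of j p] by linarith
      then have "c = b ^ (j div p)"
        using partial_char_unique[OF R _ pq] c by metis
      also have "\<dots> = z ^ j"
        using z(1) j by (metis mult.commute power_mult)
      finally show ?thesis ..
    qed
    then show ?thesis
      using that z by blast
  next
    case False
    \<comment> \<open>No positive multiple of x is in the domain, so z is free and only j = 0 has to
      be checked.\<close>
    have "(- 1) ^ j = c" if "(nat_mult j x, c) \<in> R" for j and c :: complex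
    proof -
      have "j = 0"
        using that False by force
      then show ?thesis
        using that partial_charD(5)[OF R] by auto
    qed
    then show ?thesis
      using that[of "- 1"] by simp
  qed
  have z0: "z \<noteq> 0"
    using z by auto
  \<comment> \<open>A difference of two natural multiples of x stands for an integer
    multiple.\<close>
  define R' where "R' = {(y + nat_mult n x - nat_mult k x, b * z ^ n * inverse (z ^ k)) |y b n k. (y, b) \<in> R}"
  have R'I: "(y + nat_mult n x - nat_mult k x, b * z ^ n * inverse (z ^ k)) \<in> R'" if "(y, b) \<in> R" for y b n k
    using that unfolding R'_def by blast
  have "partial_char R'"
    unfolding partial_char_def
  proof (intro conjI allI impI)
    show "(0, 1) \<in> R'"
      using R'I[OF partial_charD(1)[OF R], of 0 0] by simp
  next
    fix w a assume "(w, a) \<in> R'"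
    then obtain y b n k where w: "(y, b) \<in> R" "w = y + nat_mult n x - nat_mult k x"
        "a = b * z ^ n * inverse (z ^ k)"
      unfolding R'_def by blast
    show "cmod a = 1"
      using w z partial_charD(2)[OF R w(1)] by (simp add: norm_mult norm_power norm_inverse)
    have "(- y, inverse b) \<in> R"
      using partial_charD(3)[OF R w(1)] .
    from R'I[OF this, of k n] show "(- w, inverse a) \<in> R'"
      unfolding w by (simp add: algebra_simps)
  next
    fix w a v b assume "(w, a) \<in> R'" "(v, b) \<in> R'"
    then obtain y c n k y' c' n' k' where w: "(y, c) \<in> R" "w = y + nat_mult n x - nat_mult k x"
        "a = c * z ^ n * inverse (z ^ k)" "(y', c') \<in> R" "v = y' + nat_mult n' x - nat_mult k' x"
        "b = c' * z ^ n' * inverse (z ^ k')"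
      unfolding R'_def by blast
    have "(y + y', c * c') \<in> R"
      using partial_charD(4)[OF R] w by blast
    from R'I[OF this, of "n + n'" "k + k'"] show "(w + v, a * b) \<in> R'"
      unfolding w by (simp add: nat_mult_add power_add algebra_simps)
  next
    fix a assume "(0, a) \<in> R'"
    then obtain y b n k where w: "(y, b) \<in> R" "0 = y + nat_mult n x - nat_mult k x"
        "a = b * z ^ n * inverse (z ^ k)"
      unfolding R'_def by blast
    show "a = 1"
    proof (cases "n \<le> k")
      case True
      then have "nat_mult k x = nat_mult (k - n) x + nat_mult n x"
        by (metis le_add_diff_inverse2 nat_mult_add)
      with w(1,2) have "(nat_mult (k - n) x, b) \<in> R"
        by (metis add_right_cancel eq_iff_diff_eq_0)
      then have "b = z ^ (k - n)"
        using zR by simp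
      then show ?thesis
        using z0 True unfolding w(3) by (simp add: power_add[symmetric])
    next
      case False
      then have "nat_mult n x = nat_mult (n - k) x + nat_mult k x"
        by (metis le_add_diff_inverse2 nat_mult_add nat_le_linear)
      with w(2) have "nat_mult (n - k) x = - y"
        by (simp add: add_eq_0_iff)
      then have "inverse b = z ^ (n - k)"
        using zR partial_charD(3)[OF R w(1)] by metis
      moreover have "b \<noteq> 0"
        using partial_charD(2)[OF R w(1)] by auto
      moreover have "z ^ n = z ^ (n - k) * z ^ k"
        using False by (simp add: power_add[symmetric])
      ultimately show ?thesis
        using z0 unfolding w(3) by (simp add: field_simps)
    qed
  qed
  moreover have "R \<subseteq> R'"
    using R'I[of _ _ 0 0] by auto
  moreover have "(x, z) \<in> R'"
    using R'I[OF partial_charD(1)[OF R], of 1 0] by simp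
  ultimately show ?thesis
    using that z(2) by blast
qed

lemma partial_char_extend_total:
  fixes R :: "('g::ab_group_add \<times> complex) set"
  assumes R: "partial_char R"
  obtains \<psi> where "\<psi> \<in> dual_group" "\<And>x a. (x, a) \<in> R \<Longrightarrow> \<psi> x = a"
proof -
  let ?A = "{R'. partial_char R' \<and> R \<subseteq> R'}"
  have "\<exists>M\<in>?A. \<forall>X\<in>?A. M \<subseteq> X \<longrightarrow> X = M"
  proof (rule subset_Zorn_nonempty)
    show "?A \<noteq> {}"
      using R by auto
    fix C assume C: "C \<noteq> {}" "subset.chain ?A C"
    then have pc: "\<And>Q. Q \<in> C \<Longrightarrow> partial_char Q" "\<And>Q. Q \<in> C \<Longrightarrow> R \<subseteq> Q"
      by (auto simp: subset_chain_def)
    have "partial_char (\<Union>C)"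
      unfolding partial_char_def
    proof (intro conjI allI impI)
      show "(0, 1) \<in> \<Union>C"
        using C(1) pc(1) partial_charD(1) by blast
    next
      \<comment> \<open>Only this clause concerns two pairs at once, so only here is it needed that
        C is a chain.\<close>
      fix x y a b assume "(x, a) \<in> \<Union>C" "(y, b) \<in> \<Union>C"
      then obtain Q where "Q \<in> C" "(x, a) \<in> Q" "(y, b) \<in> Q"
        using C(2) unfolding subset_chain_def by blast
      then show "(x + y, a * b) \<in> \<Union>C"
        using pc(1) partial_charD(4) by blast
    qed (use pc(1) partial_charD in blast)+
    then show "\<Union>C \<in> ?A"
      using C(1) pc(2) by blast
  qed
  then obtain M where MA: "M \<in> ?A" and M_max: "\<forall>X\<in>?A. M \<subseteq> X \<longrightarrow> X = M"
    by (rule bexE)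
  have M: "partial_char M" "R \<subseteq> M"
    using MA by auto
  have max: "X = M" if "partial_char X" "M \<subseteq> X" for X
    using M_max that M(2) by (metis (mono_tags, lifting) mem_Collect_eq order_trans)
  have total: "x \<in> fst ` M" for x
  proof (rule ccontr)
    assume x: "x \<notin> fst ` M"
    obtain R' z where "partial_char R'" "M \<subseteq> R'" "(x, z) \<in> R'" "z \<noteq> 1"
      by (rule partial_char_extend_step[OF M(1) x])
    then have "(x, z) \<in> M"
      using max by blast
    then show False
      using x by force
  qed
  define \<psi> where "\<psi> x = (THE a. (x, a) \<in> M)" for x
  have \<psi>_eq: "\<psi> x = a" if "(x, a) \<in> M" for x a
    unfolding \<psi>_def using that partial_char_unique[OF M(1)] by blast
  have \<psi>_in: "(x, \<psi> x) \<in> M" for x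
    using total[of x] \<psi>_eq by auto
  have "\<psi> \<in> dual_group"
    unfolding dual_group_def
    using \<psi>_in \<psi>_eq partial_charD(2,4)[OF M(1)] by blast
  then show ?thesis
    using that \<psi>_eq M(2) by blast
qed

text \<open>The trivial character of L is first extended to x with a value other than 1 and only
  then to the whole group, which keeps that value.\<close>

lemma character_separates_subgroup:
  fixes L :: "'g::ab_group_add set"
  assumes "0 \<in> L" "\<And>x. x \<in> L \<Longrightarrow> - x \<in> L" "\<And>x y. x \<in> L \<Longrightarrow> y \<in> L \<Longrightarrow> x + y \<in> L"
    and "x \<notin> L"
  obtains \<psi> where "\<psi> \<in> dual_group" "\<And>y. y \<in> L \<Longrightarrow> \<psi> y = 1" "\<psi> x \<noteq> 1"
proof -
  have "partial_char (L \<times> {1})"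
    using assms(1-3) unfolding partial_char_def by auto
  moreover have "x \<notin> fst ` (L \<times> {1})"
    using assms(4) by auto
  ultimately obtain R z where R: "partial_char R" "L \<times> {1} \<subseteq> R" "(x, z) \<in> R" "z \<noteq> 1"
    by (rule partial_char_extend_step)
  obtain \<psi> where "\<psi> \<in> dual_group" "\<And>x a. (x, a) \<in> R \<Longrightarrow> \<psi> x = a"
    using partial_char_extend_total[OF R(1)] by blast
  then show ?thesis
    using R that by blast
qed

section \<open>Trigonometric polynomials on the dual group\<close>

lemma continuous_on_eval: "continuous_on S (\<lambda>\<omega>::'a \<Rightarrow> 'b::topological_space. \<omega> x)"
  by (rule continuous_on_subset[OF continuous_on_product_coordinates subset_UNIV])

lemma compact_Pi_UNIV:
  fixes K :: "'a \<Rightarrow> 'b::topological_space set"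
  assumes "\<And>i. compact (K i)"
  shows "compact (PiE UNIV K)"
proof -
  have "compactin (product_topology (\<lambda>i. euclidean) UNIV) (PiE UNIV K)"
    using assms by (simp add: compactin_PiE)
  then show ?thesis
    by (simp add: euclidean_product_topology)
qed

lemma compact_dual_group: "compact (dual_group :: ('g::{ab_group_add, countable} \<Rightarrow> complex) set)"
proof -
  have eq: "(dual_group :: ('g \<Rightarrow> complex) set) =
      PiE UNIV (\<lambda>_. sphere 0 1) \<inter> (\<Inter>x. \<Inter>y. {\<omega>. \<omega> (x + y) = \<omega> x * \<omega> y})"
    by (auto simp: dual_group_def)
  have "closed {\<omega>::'g \<Rightarrow> complex. \<omega> (x + y) = \<omega> x * \<omega> y}" for x y
    by (intro closed_Collect_eq continuous_intros continuous_on_eval)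
  then have "closed (\<Inter>x. \<Inter>y. {\<omega>::'g \<Rightarrow> complex. \<omega> (x + y) = \<omega> x * \<omega> y})"
    by (intro closed_INT ballI)
  then show ?thesis
    unfolding eq by (intro compact_Int_closed compact_Pi_UNIV) auto
qed

lemma dual_group_0: "\<omega> \<in> dual_group \<Longrightarrow> \<omega> 0 = 1"
  unfolding dual_group_def
  by (metis (mono_tags, lifting) add.right_neutral mem_Collect_eq mult_cancel_left1 norm_eq_zero zero_neq_one)

lemma dual_group_add: "\<omega> \<in> dual_group \<Longrightarrow> \<omega> (x + y) = \<omega> x * \<omega> y"
  by (simp add: dual_group_def)

lemma dual_group_norm: "\<omega> \<in> dual_group \<Longrightarrow> cmod (\<omega> x) = 1"
  by (simp add: dual_group_def)

lemma dual_group_minus: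
  assumes "\<omega> \<in> dual_group"
  shows "\<omega> (- x) = cnj (\<omega> x)"
proof -
  have "\<omega> x * \<omega> (- x) = 1"
    using assms by (metis add.right_inverse dual_group_0 dual_group_add)
  moreover have "\<omega> x * cnj (\<omega> x) = 1"
    using dual_group_norm[OF assms, of x] by (simp add: complex_norm_square[symmetric])
  ultimately show ?thesis
    by (metis mult_cancel_left mult_zero_left zero_neq_one)
qed

lemma dual_group_times: "\<omega> \<in> dual_group \<Longrightarrow> \<zeta> \<in> dual_group \<Longrightarrow> \<omega> * \<zeta> \<in> dual_group"
  by (simp add: dual_group_def norm_mult)

text \<open>Real parts of trigonometric polynomials, as Stone-Weierstrass is applied to a ring of
  real functions. The type also contains functions that are not characters, and a product of two
  evaluations is an evaluation only on \<open>dual_group\<close>; hence the rule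
  \<open>trig_cong\<close>.\<close>

inductive_set trig_poly :: "(('g::ab_group_add \<Rightarrow> complex) \<Rightarrow> real) set" where
  trig_char: "(\<lambda>\<omega>. Re (c * \<omega> x)) \<in> trig_poly"
| trig_add: "f \<in> trig_poly \<Longrightarrow> g \<in> trig_poly \<Longrightarrow> (\<lambda>\<omega>. f \<omega> + g \<omega>) \<in> trig_poly"
| trig_cong: "f \<in> trig_poly \<Longrightarrow> (\<And>\<omega>. \<omega> \<in> dual_group \<Longrightarrow> f \<omega> = g \<omega>) \<Longrightarrow> g \<in> trig_poly"

lemma trig_poly_mult:
  assumes "f \<in> trig_poly" "g \<in> trig_poly"
  shows "(\<lambda>\<omega>. f \<omega> * g \<omega>) \<in> trig_poly"
  using assms(1)
proof (induction)
  case (trig_char a x)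
  show ?case
    using assms(2)
  proof (induction)
    case (trig_char b y)
    show ?case
    proof (rule trig_cong)
      \<comment> \<open>The product-to-sum formula: Re u Re v is half of Re (u v) + Re (u
        \<open>cnj\<close> v), and conjugating a character value means evaluating at - y.\<close>
      show "(\<lambda>\<omega>. Re (a * b / 2 * \<omega> (x + y)) + Re (a * cnj b / 2 * \<omega> (x + - y))) \<in> trig_poly"
        by (intro trig_poly.trig_add trig_poly.trig_char)
      fix \<omega> :: "'a \<Rightarrow> complex" assume w: "\<omega> \<in> dual_group"
      show "Re (a * b / 2 * \<omega> (x + y)) + Re (a * cnj b / 2 * \<omega> (x + - y)) =
          Re (a * \<omega> x) * Re (b * \<omega> y)"
        unfolding dual_group_add[OF w] dual_group_minus[OF w]
        by (simp add: algebra_simps diff_divide_distrib add_divide_distrib)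
    qed
  next
    case (trig_add g h)
    then show ?case
      using trig_poly.trig_add[OF trig_add.IH] by (simp add: distrib_left)
  next
    case (trig_cong g h)
    then show ?case
      by (intro trig_poly.trig_cong[OF trig_cong.IH]) simp
  qed
next
  case (trig_add f h)
  then show ?case
    using trig_poly.trig_add[OF trig_add.IH] by (simp add: distrib_right)
next
  case (trig_cong f h)
  then show ?case
    by (intro trig_poly.trig_cong[OF trig_cong.IH]) simp
qed

lemma trig_poly_continuous: "f \<in> trig_poly \<Longrightarrow> continuous_on dual_group f"
proof (induction rule: trig_poly.induct)
  case (trig_cong f g)
  then show ?case
    using continuous_on_cong by blast
qed (auto intro!: continuous_intros continuous_on_eval)

lemma trig_poly_dense:
  fixes f :: "('g::{ab_group_add, countable} \<Rightarrow> complex) \<Rightarrow> real"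
  assumes "continuous_on dual_group f" "e > 0"
  shows "\<exists>g\<in>trig_poly. \<forall>\<omega>\<in>dual_group. \<bar>f \<omega> - g \<omega>\<bar> < e"
proof -
  interpret function_ring_on "trig_poly :: (('g \<Rightarrow> complex) \<Rightarrow> real) set" dual_group
  proof
    show "(\<lambda>_. c) \<in> trig_poly" for c
      by (rule trig_cong[OF trig_char[of c 0]]) (simp add: dual_group_0)
    fix \<omega> \<eta> :: "'g \<Rightarrow> complex" assume "\<omega> \<noteq> \<eta>"
    then obtain x where "\<omega> x \<noteq> \<eta> x"
      by blast
    \<comment> \<open>A complex number z is determined by the real parts of z and of \<i> z.\<close>
    then have "Re (1 * \<omega> x) \<noteq> Re (1 * \<eta> x) \<or> Re (\<i> * \<omega> x) \<noteq> Re (\<i> * \<eta> x)"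
      by (simp add: complex_eq_iff)
    then show "\<exists>f\<in>trig_poly. f \<omega> \<noteq> f \<eta>"
      using trig_char by (metis (mono_tags, lifting))
  qed (auto intro: compact_dual_group trig_poly_continuous trig_poly_mult trig_add)
  show ?thesis
    using Stone_Weierstrass_basic assms by blast
qed

text \<open>
  Stone-Weierstrass gives the continuous functions, bounded pointwise limits of these give the closed
  sets, and Dynkin's theorem does the rest.
\<close>

lemma dual_group_indicator_induct:
  fixes P :: "(('g::{ab_group_add, countable} \<Rightarrow> complex) \<Rightarrow> real) \<Rightarrow> bool" and M
  assumes M: "sets M = sets (restrict_space borel dual_group)"
  assumes char: "\<And>c x. P (\<lambda>\<omega>. Re (c * \<omega> x))"
    and diff: "\<And>f g B. f \<in> borel_measurable M \<Longrightarrow> g \<in> borel_measurable M \<Longrightarrow>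
      (\<And>\<omega>. \<omega> \<in> dual_group \<Longrightarrow> \<bar>f \<omega>\<bar> \<le> B) \<Longrightarrow> (\<And>\<omega>. \<omega> \<in> dual_group \<Longrightarrow> \<bar>g \<omega>\<bar> \<le> B) \<Longrightarrow>
      P f \<Longrightarrow> P g \<Longrightarrow> P (\<lambda>\<omega>. f \<omega> - g \<omega>)"
    and lim: "\<And>F f B. (\<And>n. F n \<in> borel_measurable M) \<Longrightarrow> f \<in> borel_measurable M \<Longrightarrow>
      (\<And>n \<omega>. \<omega> \<in> dual_group \<Longrightarrow> \<bar>F n \<omega>\<bar> \<le> B) \<Longrightarrow>
      (\<And>\<omega>. \<omega> \<in> dual_group \<Longrightarrow> (\<lambda>n. F n \<omega>) \<longlonglongrightarrow> f \<omega>) \<Longrightarrow> (\<And>n::nat. P (F n)) \<Longrightarrow> P f"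
    and A: "A \<in> sets M"
  shows "P (indicator A)"
proof -
  have cont_meas: "f \<in> borel_measurable M" if "continuous_on dual_group f"
    for f :: "('g \<Rightarrow> complex) \<Rightarrow> real"
    using borel_measurable_continuous_on_restrict[OF that] measurable_cong_sets[OF M refl] by blast
  have cont_bdd: "\<exists>B. \<forall>\<omega>\<in>dual_group. \<bar>f \<omega>\<bar> \<le> B" if "continuous_on dual_group f"
    for f :: "('g \<Rightarrow> complex) \<Rightarrow> real"
    using compact_imp_bounded[OF compact_continuous_image[OF that compact_dual_group]]
    unfolding bounded_iff by auto
  have diff': "P (\<lambda>\<omega>. f \<omega> - g \<omega>)"
    if f: "f \<in> borel_measurable M" "\<And>\<omega>. \<omega> \<in> dual_group \<Longrightarrow> \<bar>f \<omega>\<bar> \<le> B" "P f"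
    and g: "g \<in> borel_measurable M" "\<And>\<omega>. \<omega> \<in> dual_group \<Longrightarrow> \<bar>g \<omega>\<bar> \<le> C" "P g" for f g B C
    by (rule diff[of f g "max B C"]) (use f g in \<open>auto intro: max.coboundedI1 max.coboundedI2\<close>)
  have zero: "P (\<lambda>\<omega>. 0)"
    using char[of 0 0] by simp
  have add: "P (\<lambda>\<omega>. f \<omega> + g \<omega>)"
    if f: "f \<in> borel_measurable M" "\<And>\<omega>. \<omega> \<in> dual_group \<Longrightarrow> \<bar>f \<omega>\<bar> \<le> B" "P f"
    and g: "g \<in> borel_measurable M" "\<And>\<omega>. \<omega> \<in> dual_group \<Longrightarrow> \<bar>g \<omega>\<bar> \<le> C" "P g" for f g B C
  proof -
    have "P (\<lambda>\<omega>. 0 - g \<omega>)"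
      by (rule diff'[of _ 0 _ C]) (use g zero in auto)
    then have "P (\<lambda>\<omega>. f \<omega> - (0 - g \<omega>))"
      by (intro diff'[of f B _ C]) (use f g in auto)
    then show ?thesis
      by simp
  qed
  \<comment> \<open>A constant sequence turns closure under limits into invariance under changes off
    \<open>dual_group\<close>.\<close>
  have cong: "P g" if "P f" "f \<in> borel_measurable M" "\<And>\<omega>. \<omega> \<in> dual_group \<Longrightarrow> \<bar>f \<omega>\<bar> \<le> B"
    "\<And>\<omega>. \<omega> \<in> dual_group \<Longrightarrow> f \<omega> = g \<omega>" "g \<in> borel_measurable M" for f g B
    by (rule lim[of "\<lambda>_. f" g B]) (use that in auto)
  have trig: "P f" if "f \<in> trig_poly" for f
    using that
  proof (induction)
    case (trig_char c x)
    show ?case by (rule char)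
  next
    case (trig_add f g)
    then have c: "continuous_on dual_group f" "continuous_on dual_group g"
      using trig_poly_continuous by auto
    obtain B C where "\<And>\<omega>. \<omega> \<in> dual_group \<Longrightarrow> \<bar>f \<omega>\<bar> \<le> B" "\<And>\<omega>. \<omega> \<in> dual_group \<Longrightarrow> \<bar>g \<omega>\<bar> \<le> C"
      using cont_bdd[OF c(1)] cont_bdd[OF c(2)] by auto
    then show ?case
      by (intro add[of f B g C]) (use c cont_meas trig_add.IH in auto)
  next
    case (trig_cong f g)
    have "g \<in> trig_poly"
      using trig_cong.hyps by (rule trig_poly.trig_cong)
    then have c: "continuous_on dual_group f" "continuous_on dual_group g"
      using trig_cong.hyps(1) trig_poly_continuous by auto
    obtain B where "\<And>\<omega>. \<omega> \<in> dual_group \<Longrightarrow> \<bar>f \<omega>\<bar> \<le> B"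
      using cont_bdd[OF c(1)] by auto
    then show ?case
      by (intro cong[of f B g]) (use c cont_meas trig_cong.IH trig_cong.hyps in auto)
  qed
  have cont: "P f" if f: "continuous_on dual_group f" for f
  proof -
    obtain F where F: "\<And>n. F n \<in> trig_poly"
        "\<And>n \<omega>. \<omega> \<in> dual_group \<Longrightarrow> \<bar>f \<omega> - F n \<omega>\<bar> < inverse (real (Suc n))"
      using trig_poly_dense[OF f, of "inverse (real (Suc n))" for n] by simp metis
    obtain B where B: "\<And>\<omega>. \<omega> \<in> dual_group \<Longrightarrow> \<bar>f \<omega>\<bar> \<le> B"
      using cont_bdd[OF f] by blast
    show ?thesis
    proof (rule lim[of F f "B + 1"])
      fix n and \<omega> :: "'g \<Rightarrow> complex" assume w: "\<omega> \<in> dual_group"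
      have "inverse (real (Suc n)) \<le> 1"
        by (simp add: field_simps)
      then show "\<bar>F n \<omega>\<bar> \<le> B + 1"
        using F(2)[OF w, of n] B[OF w] by linarith
    next
      fix \<omega> :: "'g \<Rightarrow> complex" assume w: "\<omega> \<in> dual_group"
      have "(\<lambda>n. f \<omega> - F n \<omega>) \<longlonglongrightarrow> 0"
        by (rule Lim_null_comparison[OF _ LIMSEQ_inverse_real_of_nat])
          (use F(2)[OF w] in \<open>auto intro!: always_eventually less_imp_le\<close>)
      then show "(\<lambda>n. F n \<omega>) \<longlonglongrightarrow> f \<omega>"
        by (rule Lim_transform2[OF tendsto_const])
    next
      show "F n \<in> borel_measurable M" for n
        using cont_meas[OF trig_poly_continuous[OF F(1)]] .
    qed (use F trig cont_meas f in auto)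
  qed
  have "(\<lambda>\<omega>. 0) = (indicator {} :: ('g \<Rightarrow> complex) \<Rightarrow> real)"
    by (rule ext) simp
  with zero have empty: "P (indicator {})"
    by metis
  have spM: "space M = dual_group"
    using sets_eq_imp_space_eq[OF M] by (simp add: space_restrict_space)
  have ind_meas: "(indicator B :: _ \<Rightarrow> real) \<in> borel_measurable M" if "B \<in> sets borel" for B
  proof -
    have "dual_group \<inter> B \<in> sets M"
      unfolding M using that by (auto simp: sets_restrict_space)
    then have "B \<inter> space M \<in> sets M"
      by (simp add: spM Int_commute)
    then show ?thesis
      by (simp add: borel_measurable_indicator_iff del: Int_iff)
  qed
  have closed: "P (indicator C)" if C: "closed C" for C
  \<comment> \<open>\<open>infdist\<close> to the empty set is 0 by default, so the tent functions
    below would be constantly 1 for it.\<close>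
  proof (cases "C = {}")
    case True
    then show ?thesis
      using empty by (rule ssubst)
  next
    case False
    \<comment> \<open>Continuous tent functions with values in [0, 1]: they are 1 on C and vanish at
      a point off C once n times its distance to C exceeds 1.\<close>
    define F where "F n \<omega> = max 0 (1 - real n * infdist \<omega> C)" for n and \<omega> :: "'g \<Rightarrow> complex"
    show ?thesis
    proof (rule lim[of F _ 1])
      have "continuous_on dual_group (F n)" for n
        unfolding F_def by (intro continuous_intros)
      then show "F n \<in> borel_measurable M" "P (F n)" for n
        using cont cont_meas by auto
      show "(indicator C :: _ \<Rightarrow> real) \<in> borel_measurable M"
        using C by (intro ind_meas) simp
      show "\<bar>F n \<omega>\<bar> \<le> 1" for n \<omega>
      proof -
        have "0 \<le> real n * infdist \<omega> C"
          by (intro mult_nonneg_nonneg infdist_nonneg) simp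
        then show ?thesis
          unfolding F_def by linarith
      qed
      fix \<omega> :: "'g \<Rightarrow> complex"
      show "(\<lambda>n. F n \<omega>) \<longlonglongrightarrow> indicator C \<omega>"
      proof (cases "\<omega> \<in> C")
        case True
        then have "F n \<omega> = 1" for n
          unfolding F_def by (subst infdist_zero) simp_all
        with True show ?thesis
          by (simp only: indicator_simps tendsto_const)
      next
        case w: False
        then have "infdist \<omega> C > 0"
          using C False infdist_pos_not_in_closed by blast
        then obtain k where k: "1 < real k * infdist \<omega> C"
          using reals_Archimedean3 by blast
        have "F n \<omega> = 0" if "n \<ge> k" for n
        proof -
          have "real k * infdist \<omega> C \<le> real n * infdist \<omega> C"
            using that infdist_nonneg by (intro mult_right_mono) auto
          then show ?thesis
            using k unfolding F_def by auto
        qed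
        then show ?thesis
          using w by (auto intro!: tendsto_eventually eventually_sequentiallyI[of k])
      qed
    qed
  qed
  have ind_le: "\<bar>indicator B \<omega> :: real\<bar> \<le> 1" for B and \<omega> :: "'g \<Rightarrow> complex"
    by (simp add: indicator_def)
  have sets_closed: "sigma_sets UNIV (Collect closed) = sets (borel :: ('g \<Rightarrow> complex) measure)"
    by (simp add: borel_eq_closed)
  have borel: "P (indicator B)" if "B \<in> sets borel" for B
  proof -
    have *: "Int_stable (Collect (closed :: ('g \<Rightarrow> complex) set \<Rightarrow> bool))"
        "Collect closed \<subseteq> Pow (UNIV :: ('g \<Rightarrow> complex) set)"
      by (auto simp: Int_stable_def)
    have "B \<in> sigma_sets UNIV (Collect closed)"
      using that by (simp add: sets_closed)
    with * show ?thesis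
    proof (induction rule: sigma_sets_induct_disjoint)
      case (basic A)
      then show ?case
        using closed by blast
    next
      case empty
      show ?case
        using \<open>P (indicator {})\<close> .
    next
      case (compl A)
      have "P (\<lambda>\<omega>. indicator UNIV \<omega> - indicator A \<omega>)"
        by (rule diff'[OF ind_meas ind_le closed[OF closed_UNIV] ind_meas ind_le compl.IH])
          (use compl.hyps in \<open>auto simp: sets_closed\<close>)
      moreover have "(\<lambda>\<omega>. indicator UNIV \<omega> - indicator A \<omega>) = (indicator (UNIV - A) :: _ \<Rightarrow> real)"
        by (rule ext) (simp add: indicator_def)
      ultimately show ?case
        by metis
    next
      case (union A)
      then have A: "A i \<in> sets borel" for i
        by (auto simp: sets_closed)
      \<comment> \<open>Finite disjoint unions come from closure under sums; the countable union is
        their bounded pointwise limit.\<close>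
      have fin: "P (indicator (\<Union>i<n. A i))" for n
      proof (induction n)
        case 0
        show ?case
          using empty by (simp only: lessThan_0 UN_empty)
      next
        case (Suc n)
        have "P (\<lambda>\<omega>. indicator (\<Union>i<n. A i) \<omega> + indicator (A n) \<omega>)"
          by (rule add[OF ind_meas ind_le Suc.IH ind_meas ind_le union.IH]) (use A in auto)
        moreover have "(\<lambda>\<omega>. indicator (\<Union>i<n. A i) \<omega> + indicator (A n) \<omega>) =
            (indicator (\<Union>i<Suc n. A i) :: _ \<Rightarrow> real)"
        proof (rule ext)
          fix \<omega>
          have "A n \<inter> A i = {}" if "i < n" for i
            using disjoint_family_onD[OF union.hyps(1), of n i] that by simp
          then have "A n \<inter> (\<Union>i<n. A i) = {}"
            by blast
          then show "indicator (\<Union>i<n. A i) \<omega> + indicator (A n) \<omega> =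
              (indicator (\<Union>i<Suc n. A i) \<omega> :: real)"
            by (auto simp: indicator_def lessThan_Suc)
        qed
        ultimately show ?case
          by metis
      qed
      show ?case
      proof (rule lim[OF ind_meas ind_meas ind_le _ fin])
        show "(\<lambda>n. indicator (\<Union>i<n. A i) \<omega> :: real) \<longlonglongrightarrow> indicator (\<Union>i. A i) \<omega>" for \<omega>
          by (rule LIMSEQ_indicator_UN)
      qed (use A in auto)
    qed
  qed
  obtain B where B: "B \<in> sets borel" "A = dual_group \<inter> B"
    using A unfolding M by (auto simp: sets_restrict_space)
  show ?thesis
  proof (rule cong[OF borel[OF B(1)] ind_meas[OF B(1)] ind_le])
    show "indicator A \<in> borel_measurable M"
      using A by (rule borel_measurable_indicator)
  qed (simp add: B(2) indicator_def)
qed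

section \<open>Mixing of the dual endomorphism\<close>

locale haar_dual =
  fixes \<mu> :: "('g::{ab_group_add, countable} \<Rightarrow> complex) measure"
  assumes haar: "normalized_haar \<mu>"
begin

lemma sets_mu: "sets \<mu> = sets (restrict_space borel dual_group)"
  using haar by (simp add: normalized_haar_def)

lemma space_mu [simp]: "space \<mu> = dual_group"
  using sets_eq_imp_space_eq[OF sets_mu] by (simp add: space_restrict_space)

lemma emeasure_dual_group: "emeasure \<mu> dual_group = 1"
  using haar by (simp add: normalized_haar_def)

sublocale finite_measure \<mu>
  by standard (simp add: emeasure_dual_group)

lemma measure_dual_group [simp]: "measure \<mu> dual_group = 1"
  by (simp add: measure_def emeasure_dual_group)

lemma measurable_continuous:
  assumes "continuous_on dual_group f"
  shows "f \<in> borel_measurable \<mu>"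
  unfolding measurable_cong_sets[OF sets_mu refl]
  by (rule borel_measurable_continuous_on_restrict[OF assms])

lemma measurable_continuous_self:
  assumes "continuous_on dual_group f" "\<And>\<omega>. \<omega> \<in> dual_group \<Longrightarrow> f \<omega> \<in> dual_group"
  shows "f \<in> measurable \<mu> \<mu>"
proof -
  have "f \<in> measurable \<mu> (restrict_space borel dual_group)"
    using assms by (intro measurable_restrict_space2 measurable_continuous) auto
  then show ?thesis
    unfolding measurable_cong_sets[OF refl sets_mu] .
qed

lemma measurable_translation:
  assumes "\<eta> \<in> dual_group"
  shows "(*) \<eta> \<in> measurable \<mu> \<mu>"
proof (rule measurable_continuous_self)
  show "continuous_on dual_group ((*) \<eta>)"
    by (rule continuous_on_coordinatewise_then_product)
      (simp add: continuous_on_mult_left continuous_on_eval)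
qed (use assms dual_group_times in blast)

lemma distr_translation:
  assumes \<eta>: "\<eta> \<in> dual_group"
  shows "distr \<mu> \<mu> ((*) \<eta>) = \<mu>"
proof (rule measure_eqI)
  fix A assume "A \<in> sets (distr \<mu> \<mu> ((*) \<eta>))"
  then have A: "A \<in> sets \<mu>"
    by simp
  \<comment> \<open>The inverse of \<eta>. Invariance is formulated for images, and the preimage
    under translation by \<eta> is the image under translation by the inverse.\<close>
  define \<eta>' where "\<eta>' x = cnj (\<eta> x)" for x
  have \<eta>': "\<eta>' \<in> dual_group"
    using \<eta> by (simp add: dual_group_def \<eta>'_def)
  have "\<eta> x * cnj (\<eta> x) = 1" for x
    using dual_group_norm[OF \<eta>, of x] by (simp add: complex_norm_square[symmetric])
  then have "\<eta> * \<eta>' = 1" "\<eta>' * \<eta> = 1"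
    by (simp_all add: \<eta>'_def fun_eq_iff mult.commute)
  then have inv: "\<eta> * (\<eta>' * \<omega>) = \<omega>" "\<eta>' * (\<eta> * \<omega>) = \<omega>" for \<omega>
    by (simp_all only: mult.assoc[symmetric] mult_1_left)
  have "(*) \<eta> -` A \<inter> space \<mu> = (*) \<eta>' ` A"
  proof (intro set_eqI iffI)
    fix \<omega> assume "\<omega> \<in> (*) \<eta> -` A \<inter> space \<mu>"
    then show "\<omega> \<in> (*) \<eta>' ` A"
      using inv(2)[of \<omega>] by (metis IntD1 image_eqI vimageE)
  next
    fix \<omega> assume "\<omega> \<in> (*) \<eta>' ` A"
    then obtain \<xi> where "\<xi> \<in> A" "\<omega> = \<eta>' * \<xi>"
      by blast
    moreover have "\<xi> \<in> dual_group"
      using sets.sets_into_space[OF A] \<open>\<xi> \<in> A\<close> by auto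
    ultimately show "\<omega> \<in> (*) \<eta> -` A \<inter> space \<mu>"
      using \<eta>' by (simp add: inv dual_group_times)
  qed
  then show "emeasure (distr \<mu> \<mu> ((*) \<eta>)) A = emeasure \<mu> A"
    using haar \<eta>' A by (simp add: emeasure_distr measurable_translation[OF \<eta>] normalized_haar_def)
qed simp

text \<open>Translation invariance turns the scaling into I = c I for the integral I.\<close>

lemma integral_eq_0_if_translation_scales:
  fixes G :: "('g \<Rightarrow> complex) \<Rightarrow> complex"
  assumes "G \<in> borel_measurable \<mu>" "\<zeta> \<in> dual_group" "c \<noteq> 1"
    "\<And>\<omega>. \<omega> \<in> dual_group \<Longrightarrow> G (\<zeta> * \<omega>) = c * G \<omega>"
  shows "(\<integral>\<omega>. G \<omega> \<partial>\<mu>) = 0"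
proof -
  have "(\<integral>\<omega>. G \<omega> \<partial>\<mu>) = (\<integral>\<omega>. G \<omega> \<partial>distr \<mu> \<mu> ((*) \<zeta>))"
    by (simp add: distr_translation assms(2))
  also have "\<dots> = (\<integral>\<omega>. G (\<zeta> * \<omega>) \<partial>\<mu>)"
    by (rule integral_distr[OF measurable_translation[OF assms(2)] assms(1)])
  also have "\<dots> = (\<integral>\<omega>. c * G \<omega> \<partial>\<mu>)"
    by (rule Bochner_Integration.integral_cong) (use assms(4) in auto)
  also have "\<dots> = c * (\<integral>\<omega>. G \<omega> \<partial>\<mu>)"
    by simp
  finally have "(1 - c) * (\<integral>\<omega>. G \<omega> \<partial>\<mu>) = 0"
    by (simp add: algebra_simps)
  then show ?thesis
    using assms(3) by simp
qed

lemma measurable_eval [measurable]: "(\<lambda>\<omega>. \<omega> x) \<in> borel_measurable \<mu>"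
  by (intro measurable_continuous continuous_on_eval)

lemma integrable_bounded:
  fixes f :: "('g \<Rightarrow> complex) \<Rightarrow> 'b::{banach, second_countable_topology}"
  assumes "f \<in> borel_measurable \<mu>" "\<And>\<omega>. \<omega> \<in> dual_group \<Longrightarrow> norm (f \<omega>) \<le> B"
  shows "integrable \<mu> f"
  using assms by (intro integrable_const_bound[of f B]) auto

lemma integrable_bounded_real:
  fixes f :: "('g \<Rightarrow> complex) \<Rightarrow> real"
  assumes "f \<in> borel_measurable \<mu>" "\<And>\<omega>. \<omega> \<in> dual_group \<Longrightarrow> \<bar>f \<omega>\<bar> \<le> B"
  shows "integrable \<mu> f"
  using assms by (intro integrable_bounded[of f B]) auto

lemma integral_char:
  assumes "x \<noteq> 0"
  shows "(\<integral>\<omega>. \<omega> x \<partial>\<mu>) = 0"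
proof -
  obtain \<zeta> where \<zeta>: "\<zeta> \<in> dual_group" "\<zeta> x \<noteq> 1"
    using character_separates_subgroup[of "{0}" x] assms by auto
  then show ?thesis
    by (intro integral_eq_0_if_translation_scales[of _ \<zeta> "\<zeta> x"]) auto
qed

lemma dual_map_in_dual_group:
  assumes "\<And>x y. \<beta> (x + y) = \<beta> x + \<beta> y" "\<omega> \<in> dual_group"
  shows "dual_map \<beta> \<omega> \<in> dual_group"
  using assms by (simp add: dual_map_def dual_group_def)

lemma measurable_dual_map:
  assumes "\<And>x y. \<beta> (x + y) = \<beta> x + \<beta> y"
  shows "dual_map \<beta> \<in> measurable \<mu> \<mu>"
proof (rule measurable_continuous_self)
  show "continuous_on dual_group (dual_map \<beta>)"
    unfolding dual_map_def
    by (rule continuous_on_coordinatewise_then_product) (rule continuous_on_eval)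
qed (rule dual_map_in_dual_group[OF assms])

text \<open>Both measures have the same Fourier coefficients: for x \<noteq> 0 injectivity gives
  \<beta> x \<noteq> 0, so the characters at x and at \<beta> x both integrate to 0.
  \<open>dual_group_indicator_induct\<close> carries the equality over to indicators.\<close>

lemma distr_dual_map:
  assumes add: "\<And>x y. \<beta> (x + y) = \<beta> x + \<beta> y" and "inj \<beta>"
  shows "distr \<mu> \<mu> (dual_map \<beta>) = \<mu>"
proof (rule measure_eqI)
  fix A assume "A \<in> sets (distr \<mu> \<mu> (dual_map \<beta>))"
  then have A: "A \<in> sets \<mu>"
    by simp
  note [measurable] = measurable_dual_map[OF add]
  have \<beta>0: "\<beta> 0 = 0"
    using add[of 0 0] by simp
  have "(\<integral>\<omega>. indicator A \<omega> \<partial>\<mu>) = (\<integral>\<omega>. (indicator A (dual_map \<beta> \<omega>) :: real) \<partial>\<mu>)"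
  proof (rule dual_group_indicator_induct[OF sets_mu _ _ _ A,
        of "\<lambda>f. (\<integral>\<omega>. f \<omega> \<partial>\<mu>) = (\<integral>\<omega>. f (dual_map \<beta> \<omega>) \<partial>\<mu>)"])
    fix c x
    have int: "integrable \<mu> (\<lambda>\<omega>. c * \<omega> y)" for y
      by (rule integrable_bounded[of _ "cmod c"]) (simp_all add: norm_mult dual_group_norm)
    have "(\<integral>\<omega>. Re (c * \<omega> y) \<partial>\<mu>) = Re (c * (\<integral>\<omega>. \<omega> y \<partial>\<mu>))" for y
      using integral_Re[OF int[of y]] by simp
    moreover have "(\<integral>\<omega>. \<omega> x \<partial>\<mu>) = (\<integral>\<omega>. \<omega> (\<beta> x) \<partial>\<mu>)"
    proof (cases "x = 0")
      case False
      then have "\<beta> x \<noteq> 0"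
        using \<open>inj \<beta>\<close> \<beta>0 by (metis injD)
      then show ?thesis
        using False by (simp add: integral_char)
    qed (simp add: \<beta>0)
    ultimately show "(\<integral>\<omega>. Re (c * \<omega> x) \<partial>\<mu>) = (\<integral>\<omega>. Re (c * dual_map \<beta> \<omega> x) \<partial>\<mu>)"
      by (simp add: dual_map_def)
  next
    fix f g :: "('g \<Rightarrow> complex) \<Rightarrow> real" and B
    assume [measurable]: "f \<in> borel_measurable \<mu>" "g \<in> borel_measurable \<mu>"
      and B: "\<And>\<omega>. \<omega> \<in> dual_group \<Longrightarrow> \<bar>f \<omega>\<bar> \<le> B" "\<And>\<omega>. \<omega> \<in> dual_group \<Longrightarrow> \<bar>g \<omega>\<bar> \<le> B"
      and eq: "(\<integral>\<omega>. f \<omega> \<partial>\<mu>) = (\<integral>\<omega>. f (dual_map \<beta> \<omega>) \<partial>\<mu>)"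
        "(\<integral>\<omega>. g \<omega> \<partial>\<mu>) = (\<integral>\<omega>. g (dual_map \<beta> \<omega>) \<partial>\<mu>)"
    have "integrable \<mu> f" "integrable \<mu> g"
      "integrable \<mu> (\<lambda>\<omega>. f (dual_map \<beta> \<omega>))" "integrable \<mu> (\<lambda>\<omega>. g (dual_map \<beta> \<omega>))"
      by (rule integrable_bounded[of _ B]; use B dual_map_in_dual_group[OF add] in simp)+
    then show "(\<integral>\<omega>. f \<omega> - g \<omega> \<partial>\<mu>) = (\<integral>\<omega>. f (dual_map \<beta> \<omega>) - g (dual_map \<beta> \<omega>) \<partial>\<mu>)"
      using eq by simp
  next
    fix F :: "nat \<Rightarrow> ('g \<Rightarrow> complex) \<Rightarrow> real" and f B
    assume [measurable]: "\<And>n. F n \<in> borel_measurable \<mu>" "f \<in> borel_measurable \<mu>"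
      and B: "\<And>n \<omega>. \<omega> \<in> dual_group \<Longrightarrow> \<bar>F n \<omega>\<bar> \<le> B"
      and lim: "\<And>\<omega>. \<omega> \<in> dual_group \<Longrightarrow> (\<lambda>n. F n \<omega>) \<longlonglongrightarrow> f \<omega>"
      and eq: "\<And>n. (\<integral>\<omega>. F n \<omega> \<partial>\<mu>) = (\<integral>\<omega>. F n (dual_map \<beta> \<omega>) \<partial>\<mu>)"
    have "(\<lambda>n. \<integral>\<omega>. F n \<omega> \<partial>\<mu>) \<longlonglongrightarrow> (\<integral>\<omega>. f \<omega> \<partial>\<mu>)"
      by (rule integral_dominated_convergence[where w = "\<lambda>_. B"]) (use B lim in auto)
    moreover have "(\<lambda>n. \<integral>\<omega>. F n (dual_map \<beta> \<omega>) \<partial>\<mu>) \<longlonglongrightarrow> (\<integral>\<omega>. f (dual_map \<beta> \<omega>) \<partial>\<mu>)"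
      by (rule integral_dominated_convergence[where w = "\<lambda>_. B"])
        (use B lim dual_map_in_dual_group[OF add] in auto)
    ultimately show "(\<integral>\<omega>. f \<omega> \<partial>\<mu>) = (\<integral>\<omega>. f (dual_map \<beta> \<omega>) \<partial>\<mu>)"
      unfolding eq by (rule LIMSEQ_unique)
  qed
  also have "\<dots> = (\<integral>\<omega>. indicator A \<omega> \<partial>distr \<mu> \<mu> (dual_map \<beta>))"
    using A by (intro integral_distr[symmetric]) auto
  finally have "measure \<mu> A = measure (distr \<mu> \<mu> (dual_map \<beta>)) A"
    using sets.sets_into_space[OF A] by (simp add: Int_absorb1 Int_absorb2)
  moreover have "finite_measure (distr \<mu> \<mu> (dual_map \<beta>))"
    by (rule finite_measure_distr) simp
  ultimately show "emeasure (distr \<mu> \<mu> (dual_map \<beta>)) A = emeasure \<mu> A"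
    by (simp add: finite_measure.emeasure_eq_measure emeasure_eq_measure)
qed simp

lemma measure_dual_map_vimage:
  assumes "\<And>x y. \<beta> (x + y) = \<beta> x + \<beta> y" "inj \<beta>" "A \<in> sets \<mu>"
  shows "measure \<mu> (dual_map \<beta> -` A \<inter> dual_group) = measure \<mu> A"
  using measure_distr[OF measurable_dual_map[OF assms(1)] assms(3)] distr_dual_map[OF assms(1,2)]
  by simp

lemma AE_dual_map:
  assumes "\<And>x y. \<beta> (x + y) = \<beta> x + \<beta> y" "inj \<beta>" "AE \<omega> in \<mu>. P \<omega>"
  shows "AE \<omega> in \<mu>. P (dual_map \<beta> \<omega>)"
proof -
  have "AE \<omega> in distr \<mu> \<mu> (dual_map \<beta>). P \<omega>"
    using assms(3) unfolding distr_dual_map[OF assms(1,2)] .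
  then show ?thesis
    by (rule AE_distrD[OF measurable_dual_map[OF assms(1)]])
qed

end

section \<open>Uniform mixing and L1 convergence to the mean\<close>

locale haar_endo = haar_dual \<mu>
  for \<mu> :: "('g::{ab_group_add, countable} \<Rightarrow> complex) measure" +
  fixes \<alpha> :: "'g \<Rightarrow> 'g"
  assumes \<alpha>_add: "\<alpha> (x + y) = \<alpha> x + \<alpha> y"
    and \<alpha>_inj: "inj \<alpha>"
    and \<alpha>_Int: "(\<Inter>n. range (\<alpha> ^^ n)) = {0}"
begin

lemma \<alpha>_pow_add: "(\<alpha> ^^ n) (x + y) = (\<alpha> ^^ n) x + (\<alpha> ^^ n) y"
  by (induction n) (simp_all add: \<alpha>_add)

lemma \<alpha>_pow_inj: "inj (\<alpha> ^^ n)"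
  by (rule inj_fn[OF \<alpha>_inj])

abbreviation T :: "nat \<Rightarrow> ('g \<Rightarrow> complex) \<Rightarrow> 'g \<Rightarrow> complex" where
  "T n \<equiv> dual_map (\<alpha> ^^ n)"

lemma measurable_T [measurable]: "T n \<in> measurable \<mu> \<mu>"
  by (rule measurable_dual_map[OF \<alpha>_pow_add])

lemma T_in: "\<omega> \<in> dual_group \<Longrightarrow> T n \<omega> \<in> dual_group"
  by (rule dual_map_in_dual_group[OF \<alpha>_pow_add])

text \<open>A character \<zeta> that is trivial on the range of \<alpha>^n is in the kernel of
  \<open>T n\<close>, so translation by it fixes the indicator and multiplies the integrand by
  \<zeta> x. As x lies outside that subgroup, \<zeta> can be chosen with \<zeta> x \<noteq>
  1.\<close>

lemma integral_char_mult_indicator: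
  assumes x: "x \<notin> range (\<alpha> ^^ n)" and A: "A \<in> sets \<mu>"
  shows "(\<integral>\<omega>. \<omega> x * indicator A (T n \<omega>) \<partial>\<mu>) = (0 :: complex)"
proof -
  have n0: "(\<alpha> ^^ n) 0 = 0"
    using \<alpha>_pow_add[of n 0 0] by simp
  have minus: "(\<alpha> ^^ n) (- y) = - (\<alpha> ^^ n) y" for y
    using \<alpha>_pow_add[of n y "- y"] n0 by (simp add: eq_neg_iff_add_eq_0 add.commute)
  obtain \<zeta> where \<zeta>: "\<zeta> \<in> dual_group" "\<And>y. y \<in> range (\<alpha> ^^ n) \<Longrightarrow> \<zeta> y = 1" "\<zeta> x \<noteq> 1"
  proof (rule character_separates_subgroup[of "range (\<alpha> ^^ n)" x])
    show "0 \<in> range (\<alpha> ^^ n)"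
      using n0 by (metis rangeI)
    show "- y \<in> range (\<alpha> ^^ n)" if "y \<in> range (\<alpha> ^^ n)" for y
      using that by (auto simp flip: minus)
    show "y + z \<in> range (\<alpha> ^^ n)" if "y \<in> range (\<alpha> ^^ n)" "z \<in> range (\<alpha> ^^ n)" for y z
      using that by (auto simp flip: \<alpha>_pow_add)
  qed (use x in auto)
  have "T n (\<zeta> * \<omega>) = T n \<omega>" for \<omega>
    using \<zeta>(2) by (simp add: dual_map_def fun_eq_iff)
  moreover have "(\<lambda>\<omega>. \<omega> x * indicator A (T n \<omega>)) \<in> borel_measurable \<mu>"
    using A by measurable
  ultimately show ?thesis
    using \<zeta> by (intro integral_eq_0_if_translation_scales[of _ \<zeta> "\<zeta> x"]) auto
qed

definition mixes :: "(('g \<Rightarrow> complex) \<Rightarrow> real) \<Rightarrow> bool" where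
  "mixes h \<longleftrightarrow> (\<forall>e>0. \<exists>N. \<forall>n\<ge>N. \<forall>A\<in>sets \<mu>.
     \<bar>(\<integral>\<omega>. h \<omega> * indicator A (T n \<omega>) \<partial>\<mu>) - (\<integral>\<omega>. h \<omega> \<partial>\<mu>) * measure \<mu> A\<bar> \<le> e)"

lemma mixesD:
  assumes "mixes h" "e > 0"
  shows "\<exists>N. \<forall>n\<ge>N. \<forall>A\<in>sets \<mu>.
    \<bar>(\<integral>\<omega>. h \<omega> * indicator A (T n \<omega>) \<partial>\<mu>) - (\<integral>\<omega>. h \<omega> \<partial>\<mu>) * measure \<mu> A\<bar> \<le> e"
  using assms(1)[unfolded mixes_def, rule_format, OF assms(2)] .

lemma integrable_mult_indicator_T:
  fixes h :: "('g \<Rightarrow> complex) \<Rightarrow> real"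
  assumes "integrable \<mu> h" "A \<in> sets \<mu>"
  shows "integrable \<mu> (\<lambda>\<omega>. h \<omega> * indicator A (T n \<omega>))"
  using assms(1)
proof (rule Bochner_Integration.integrable_bound)
  show "(\<lambda>\<omega>. h \<omega> * indicator A (T n \<omega>)) \<in> borel_measurable \<mu>"
    using assms by measurable
qed (auto simp: indicator_def)

text \<open>Replacing h by g moves each of the two terms by at most the L1 distance of h and g, for
  all n and A at once; three errors of e / 3 add up.\<close>

lemma mixes_L1_closed:
  assumes h: "integrable \<mu> h"
    and app: "\<And>e. e > 0 \<Longrightarrow> \<exists>g. integrable \<mu> g \<and> mixes g \<and> (\<integral>\<omega>. \<bar>h \<omega> - g \<omega>\<bar> \<partial>\<mu>) \<le> e"
  shows "mixes h"
  unfolding mixes_def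
proof (intro allI impI)
  fix e :: real assume e: "e > 0"
  obtain g where g: "integrable \<mu> g" "mixes g" "(\<integral>\<omega>. \<bar>h \<omega> - g \<omega>\<bar> \<partial>\<mu>) \<le> e / 3"
    using app[of "e / 3"] e by auto
  obtain N where N: "\<forall>n\<ge>N. \<forall>A\<in>sets \<mu>.
      \<bar>(\<integral>\<omega>. g \<omega> * indicator A (T n \<omega>) \<partial>\<mu>) - (\<integral>\<omega>. g \<omega> \<partial>\<mu>) * measure \<mu> A\<bar> \<le> e / 3"
    using mixesD[OF g(2) divide_pos_pos[OF e zero_less_numeral]] by (rule exE)
  have d: "integrable \<mu> (\<lambda>\<omega>. h \<omega> - g \<omega>)"
    using h g(1) by simp
  show "\<exists>N. \<forall>n\<ge>N. \<forall>A\<in>sets \<mu>.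
      \<bar>(\<integral>\<omega>. h \<omega> * indicator A (T n \<omega>) \<partial>\<mu>) - (\<integral>\<omega>. h \<omega> \<partial>\<mu>) * measure \<mu> A\<bar> \<le> e"
  proof (intro exI[of _ N] allI impI ballI)
    fix n A assume n: "n \<ge> N" and A: "A \<in> sets \<mu>"
    have "\<bar>\<integral>\<omega>. (h \<omega> - g \<omega>) * indicator A (T n \<omega>) \<partial>\<mu>\<bar> \<le> (\<integral>\<omega>. \<bar>h \<omega> - g \<omega>\<bar> \<partial>\<mu>)"
    proof (rule order_trans[OF integral_abs_bound integral_mono])
      show "integrable \<mu> (\<lambda>\<omega>. \<bar>(h \<omega> - g \<omega>) * indicator A (T n \<omega>)\<bar>)"
        by (rule integrable_abs[OF integrable_mult_indicator_T[OF d A]])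
      show "integrable \<mu> (\<lambda>\<omega>. \<bar>h \<omega> - g \<omega>\<bar>)"
        by (rule integrable_abs[OF d])
    qed (simp add: indicator_def)
    moreover have "(\<integral>\<omega>. (h \<omega> - g \<omega>) * indicator A (T n \<omega>) \<partial>\<mu>) =
        (\<integral>\<omega>. h \<omega> * indicator A (T n \<omega>) \<partial>\<mu>) - (\<integral>\<omega>. g \<omega> * indicator A (T n \<omega>) \<partial>\<mu>)"
      using integrable_mult_indicator_T[OF h A] integrable_mult_indicator_T[OF g(1) A]
      by (simp add: left_diff_distrib)
    moreover have "\<bar>(\<integral>\<omega>. h \<omega> \<partial>\<mu>) * measure \<mu> A - (\<integral>\<omega>. g \<omega> \<partial>\<mu>) * measure \<mu> A\<bar> \<le> (\<integral>\<omega>. \<bar>h \<omega> - g \<omega>\<bar> \<partial>\<mu>)"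
    proof -
      have "\<bar>(\<integral>\<omega>. h \<omega> \<partial>\<mu>) - (\<integral>\<omega>. g \<omega> \<partial>\<mu>)\<bar> \<le> (\<integral>\<omega>. \<bar>h \<omega> - g \<omega>\<bar> \<partial>\<mu>)"
        using integral_abs_bound[of \<mu> "\<lambda>\<omega>. h \<omega> - g \<omega>"] h g(1) by simp
      moreover have "measure \<mu> A \<le> 1"
        using bounded_measure[of A] by simp
      ultimately have "\<bar>(\<integral>\<omega>. h \<omega> \<partial>\<mu>) - (\<integral>\<omega>. g \<omega> \<partial>\<mu>)\<bar> * measure \<mu> A \<le> (\<integral>\<omega>. \<bar>h \<omega> - g \<omega>\<bar> \<partial>\<mu>) * 1"
        by (intro mult_mono) auto
      then show ?thesis
        by (simp add: left_diff_distrib[symmetric] abs_mult)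
    qed
    ultimately show "\<bar>(\<integral>\<omega>. h \<omega> * indicator A (T n \<omega>) \<partial>\<mu>) - (\<integral>\<omega>. h \<omega> \<partial>\<mu>) * measure \<mu> A\<bar> \<le> e"
      using N[rule_format, OF n A] g(3) by linarith
  qed
qed

lemma mixes_diff:
  assumes f: "integrable \<mu> f" "mixes f" and g: "integrable \<mu> g" "mixes g"
  shows "mixes (\<lambda>\<omega>. f \<omega> - g \<omega>)"
  unfolding mixes_def
proof (intro allI impI)
  fix e :: real assume e: "e > 0"
  obtain N where N: "\<forall>n\<ge>N. \<forall>A\<in>sets \<mu>.
      \<bar>(\<integral>\<omega>. f \<omega> * indicator A (T n \<omega>) \<partial>\<mu>) - (\<integral>\<omega>. f \<omega> \<partial>\<mu>) * measure \<mu> A\<bar> \<le> e / 2"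
    using mixesD[OF f(2) divide_pos_pos[OF e zero_less_numeral]] by (rule exE)
  obtain N' where N': "\<forall>n\<ge>N'. \<forall>A\<in>sets \<mu>.
      \<bar>(\<integral>\<omega>. g \<omega> * indicator A (T n \<omega>) \<partial>\<mu>) - (\<integral>\<omega>. g \<omega> \<partial>\<mu>) * measure \<mu> A\<bar> \<le> e / 2"
    using mixesD[OF g(2) divide_pos_pos[OF e zero_less_numeral]] by (rule exE)
  show "\<exists>N. \<forall>n\<ge>N. \<forall>A\<in>sets \<mu>. \<bar>(\<integral>\<omega>. (f \<omega> - g \<omega>) * indicator A (T n \<omega>) \<partial>\<mu>) -
      (\<integral>\<omega>. f \<omega> - g \<omega> \<partial>\<mu>) * measure \<mu> A\<bar> \<le> e"
  proof (intro exI[of _ "max N N'"] allI impI ballI)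
    fix n A assume n: "n \<ge> max N N'" and A: "A \<in> sets \<mu>"
    have "(\<integral>\<omega>. (f \<omega> - g \<omega>) * indicator A (T n \<omega>) \<partial>\<mu>) =
        (\<integral>\<omega>. f \<omega> * indicator A (T n \<omega>) \<partial>\<mu>) - (\<integral>\<omega>. g \<omega> * indicator A (T n \<omega>) \<partial>\<mu>)"
      using integrable_mult_indicator_T[OF f(1) A] integrable_mult_indicator_T[OF g(1) A]
      by (simp add: left_diff_distrib)
    moreover have "(\<integral>\<omega>. f \<omega> - g \<omega> \<partial>\<mu>) * measure \<mu> A =
        (\<integral>\<omega>. f \<omega> \<partial>\<mu>) * measure \<mu> A - (\<integral>\<omega>. g \<omega> \<partial>\<mu>) * measure \<mu> A"
      using f g by (simp add: left_diff_distrib)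
    moreover have "\<bar>(\<integral>\<omega>. f \<omega> * indicator A (T n \<omega>) \<partial>\<mu>) - (\<integral>\<omega>. f \<omega> \<partial>\<mu>) * measure \<mu> A\<bar> \<le> e / 2"
      "\<bar>(\<integral>\<omega>. g \<omega> * indicator A (T n \<omega>) \<partial>\<mu>) - (\<integral>\<omega>. g \<omega> \<partial>\<mu>) * measure \<mu> A\<bar> \<le> e / 2"
      using N[rule_format, OF _ A] N'[rule_format, OF _ A] n by auto
    ultimately show "\<bar>(\<integral>\<omega>. (f \<omega> - g \<omega>) * indicator A (T n \<omega>) \<partial>\<mu>) -
        (\<integral>\<omega>. f \<omega> - g \<omega> \<partial>\<mu>) * measure \<mu> A\<bar> \<le> e"
      by linarith
  qed
qed

lemma range_\<alpha>_pow_antimono: "n \<le> k \<Longrightarrow> range (\<alpha> ^^ k) \<subseteq> range (\<alpha> ^^ n)"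
  by (metis (no_types, lifting) comp_apply funpow_add image_subset_iff le_add_diff_inverse rangeI subsetI)

text \<open>Both sides agree exactly from some N on. For x = 0 this is invariance of the measure;
  any other x eventually leaves the decreasing subgroups \<alpha>^n(\<Gamma>), and then both
  integrals vanish. N depends on x and not on A.\<close>

lemma mixes_char: "mixes (\<lambda>\<omega>. Re (c * \<omega> x))"
proof -
  have int: "integrable \<mu> (\<lambda>\<omega>. c * \<omega> x * indicator A (T n \<omega>))" if A: "A \<in> sets \<mu>" for n A
    by (rule integrable_bounded[of _ "cmod c"])
      (use A in \<open>auto simp: norm_mult dual_group_norm indicator_def\<close>)
  have int': "integrable \<mu> (\<lambda>\<omega>. c * \<omega> x)"
    by (rule integrable_bounded[of _ "cmod c"]) (auto simp: norm_mult dual_group_norm)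
  have Re_ind: "Re z * indicator A \<omega> = Re (z * indicator A \<omega>)" for z and A and \<omega> :: "'g \<Rightarrow> complex"
    by (simp add: indicator_def)
  have eq: "(\<integral>\<omega>. Re (c * \<omega> x) * indicator A (T n \<omega>) \<partial>\<mu>) =
      Re (c * (\<integral>\<omega>. \<omega> x * indicator A (T n \<omega>) \<partial>\<mu>))" if A: "A \<in> sets \<mu>" for n A
    unfolding Re_ind integral_Re[OF int[OF A]] by (simp add: mult.assoc)
  have eq': "(\<integral>\<omega>. Re (c * \<omega> x) \<partial>\<mu>) = Re (c * (\<integral>\<omega>. \<omega> x \<partial>\<mu>))"
    unfolding integral_Re[OF int'] by simp
  have "\<exists>N. \<forall>n\<ge>N. \<forall>A\<in>sets \<mu>. (\<integral>\<omega>. Re (c * \<omega> x) * indicator A (T n \<omega>) \<partial>\<mu>) =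
      (\<integral>\<omega>. Re (c * \<omega> x) \<partial>\<mu>) * measure \<mu> A"
  proof (cases "x = 0")
    case True
    have "(\<integral>\<omega>. Re (c * \<omega> x) * indicator A (T n \<omega>) \<partial>\<mu>) =
        (\<integral>\<omega>. Re (c * \<omega> x) \<partial>\<mu>) * measure \<mu> A" if A: "A \<in> sets \<mu>" for n A
    proof -
      have "(\<integral>\<omega>. Re (c * \<omega> x) * indicator A (T n \<omega>) \<partial>\<mu>) =
          (\<integral>\<omega>. Re c * indicator (T n -` A \<inter> dual_group) \<omega> \<partial>\<mu>)"
        by (rule Bochner_Integration.integral_cong) (auto simp: True dual_group_0 indicator_def)
      also have "\<dots> = Re c * measure \<mu> (T n -` A \<inter> dual_group)"
        using measurable_sets[OF measurable_T A] by simp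
      also have "\<dots> = Re c * measure \<mu> A"
        by (simp add: measure_dual_map_vimage[OF \<alpha>_pow_add \<alpha>_pow_inj A])
      also have "Re c = (\<integral>\<omega>. Re c \<partial>\<mu>)"
        by simp
      also have "\<dots> = (\<integral>\<omega>. Re (c * \<omega> x) \<partial>\<mu>)"
        by (rule Bochner_Integration.integral_cong) (auto simp: True dual_group_0)
      finally show ?thesis .
    qed
    then show ?thesis
      by blast
  next
    case False
    then have "x \<notin> (\<Inter>n. range (\<alpha> ^^ n))"
      unfolding \<alpha>_Int by simp
    then obtain N where N: "x \<notin> range (\<alpha> ^^ N)"
      by blast
    then have nr: "x \<notin> range (\<alpha> ^^ n)" if "n \<ge> N" for n
      using range_\<alpha>_pow_antimono[OF that] by (rule contra_subsetD[rotated])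
    have "(\<integral>\<omega>. Re (c * \<omega> x) * indicator A (T n \<omega>) \<partial>\<mu>) =
        (\<integral>\<omega>. Re (c * \<omega> x) \<partial>\<mu>) * measure \<mu> A" if "n \<ge> N" "A \<in> sets \<mu>" for n A
      unfolding eq[OF that(2)] eq' integral_char[OF False]
        integral_char_mult_indicator[OF nr[OF that(1)] that(2)] by simp
    then show ?thesis
      by (intro exI[of _ N]) simp
  qed
  then obtain N where "\<And>n A. n \<ge> N \<Longrightarrow> A \<in> sets \<mu> \<Longrightarrow>
      (\<integral>\<omega>. Re (c * \<omega> x) * indicator A (T n \<omega>) \<partial>\<mu>) = (\<integral>\<omega>. Re (c * \<omega> x) \<partial>\<mu>) * measure \<mu> A"
    by blast
  then show ?thesis
    unfolding mixes_def by (intro allI impI exI[of _ N] ballI) simp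
qed

text \<open>The dominating function may be any integrable w, so that the lemma serves bounded limits
  as well as the passage to arbitrary integrable functions.\<close>

lemma mixes_lim:
  assumes F: "\<And>n::nat. integrable \<mu> (F n)" "\<And>n. mixes (F n)"
    and [measurable]: "f \<in> borel_measurable \<mu>" and w: "integrable \<mu> w"
    and bd: "\<And>n \<omega>. \<omega> \<in> dual_group \<Longrightarrow> \<bar>F n \<omega>\<bar> \<le> w \<omega>"
    and lim: "\<And>\<omega>. \<omega> \<in> dual_group \<Longrightarrow> (\<lambda>n. F n \<omega>) \<longlonglongrightarrow> f \<omega>"
  shows "mixes f"
proof (rule mixes_L1_closed)
  have [measurable]: "F n \<in> borel_measurable \<mu>" for n
    using F(1) by auto
  have [measurable]: "w \<in> borel_measurable \<mu>"
    using w by auto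
  show f: "integrable \<mu> f"
    by (rule integrable_dominated_convergence[where w = w and s = F]) (use w bd lim in auto)
  have "(\<lambda>n. \<integral>\<omega>. \<bar>f \<omega> - F n \<omega>\<bar> \<partial>\<mu>) \<longlonglongrightarrow> (\<integral>\<omega>. 0 \<partial>\<mu>)"
  proof (rule integral_dominated_convergence[where w = "\<lambda>\<omega>. \<bar>f \<omega>\<bar> + w \<omega>"])
    show "AE \<omega> in \<mu>. (\<lambda>n. \<bar>f \<omega> - F n \<omega>\<bar>) \<longlonglongrightarrow> 0"
    proof (rule AE_I2)
      fix \<omega> assume "\<omega> \<in> space \<mu>"
      then have "(\<lambda>n. \<bar>f \<omega> - F n \<omega>\<bar>) \<longlonglongrightarrow> \<bar>f \<omega> - f \<omega>\<bar>"
        using lim by (intro tendsto_intros) auto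
      then show "(\<lambda>n. \<bar>f \<omega> - F n \<omega>\<bar>) \<longlonglongrightarrow> 0"
        by simp
    qed
    show "AE \<omega> in \<mu>. norm \<bar>f \<omega> - F n \<omega>\<bar> \<le> \<bar>f \<omega>\<bar> + w \<omega>" for n
    proof (rule AE_I2)
      fix \<omega> assume "\<omega> \<in> space \<mu>"
      then show "norm \<bar>f \<omega> - F n \<omega>\<bar> \<le> \<bar>f \<omega>\<bar> + w \<omega>"
        using bd[of \<omega> n] by simp
    qed
  qed (use f w in auto)
  then have lim0: "(\<lambda>n. \<integral>\<omega>. \<bar>f \<omega> - F n \<omega>\<bar> \<partial>\<mu>) \<longlonglongrightarrow> 0"
    by simp
  fix e :: real assume "e > 0"
  then obtain n where "(\<integral>\<omega>. \<bar>f \<omega> - F n \<omega>\<bar> \<partial>\<mu>) < e"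
    using order_tendstoD(2)[OF lim0] by (meson eventually_happens sequentially_bot)
  then show "\<exists>g. integrable \<mu> g \<and> mixes g \<and> (\<integral>\<omega>. \<bar>f \<omega> - g \<omega>\<bar> \<partial>\<mu>) \<le> e"
    using F by (intro exI[of _ "F n"]) auto
qed

lemma mixes_indicator:
  assumes "A \<in> sets \<mu>"
  shows "mixes (indicator A)"
proof (rule dual_group_indicator_induct[where P = mixes, OF sets_mu])
  show "mixes (\<lambda>\<omega>. f \<omega> - g \<omega>)"
    if "f \<in> borel_measurable \<mu>" "g \<in> borel_measurable \<mu>"
      "\<And>\<omega>. \<omega> \<in> dual_group \<Longrightarrow> \<bar>f \<omega>\<bar> \<le> B" "\<And>\<omega>. \<omega> \<in> dual_group \<Longrightarrow> \<bar>g \<omega>\<bar> \<le> B" "mixes f" "mixes g" for f g B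
    using that integrable_bounded_real by (intro mixes_diff) blast+
  show "mixes f"
    if "\<And>n. F n \<in> borel_measurable \<mu>" "f \<in> borel_measurable \<mu>"
      "\<And>n \<omega>. \<omega> \<in> dual_group \<Longrightarrow> \<bar>F n \<omega>\<bar> \<le> B"
      "\<And>\<omega>. \<omega> \<in> dual_group \<Longrightarrow> (\<lambda>n. F n \<omega>) \<longlonglongrightarrow> f \<omega>" "\<And>n::nat. mixes (F n)" for F f B
  proof (rule mixes_lim[of F f "\<lambda>_. B"])
    show "integrable \<mu> (F n)" for n
      by (rule integrable_bounded_real) (fact that)+
  qed (use that in auto)
qed (fact mixes_char assms)+

lemma mixes_scale:
  assumes "mixes f"
  shows "mixes (\<lambda>\<omega>. c * f \<omega>)"
  unfolding mixes_def
proof (intro allI impI)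
  fix e :: real assume e: "e > 0"
  have ec: "e / (\<bar>c\<bar> + 1) > 0"
    using e by (intro divide_pos_pos) auto
  obtain N where N: "\<forall>n\<ge>N. \<forall>A\<in>sets \<mu>.
      \<bar>(\<integral>\<omega>. f \<omega> * indicator A (T n \<omega>) \<partial>\<mu>) - (\<integral>\<omega>. f \<omega> \<partial>\<mu>) * measure \<mu> A\<bar> \<le> e / (\<bar>c\<bar> + 1)"
    using mixesD[OF assms ec] by (rule exE)
  show "\<exists>N. \<forall>n\<ge>N. \<forall>A\<in>sets \<mu>. \<bar>(\<integral>\<omega>. c * f \<omega> * indicator A (T n \<omega>) \<partial>\<mu>) -
      (\<integral>\<omega>. c * f \<omega> \<partial>\<mu>) * measure \<mu> A\<bar> \<le> e"
  proof (intro exI[of _ N] allI impI ballI)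
    fix n A assume n: "n \<ge> N" and A: "A \<in> sets \<mu>"
    have "\<bar>(\<integral>\<omega>. c * f \<omega> * indicator A (T n \<omega>) \<partial>\<mu>) - (\<integral>\<omega>. c * f \<omega> \<partial>\<mu>) * measure \<mu> A\<bar> =
      \<bar>c\<bar> * \<bar>(\<integral>\<omega>. f \<omega> * indicator A (T n \<omega>) \<partial>\<mu>) - (\<integral>\<omega>. f \<omega> \<partial>\<mu>) * measure \<mu> A\<bar>"
      by (simp add: mult.assoc abs_mult[symmetric] right_diff_distrib)
    also have "\<dots> \<le> (\<bar>c\<bar> + 1) * (e / (\<bar>c\<bar> + 1))"
      using N[rule_format, OF n A] by (intro mult_mono) auto
    also have "\<dots> = e"
      by (simp add: field_simps)
    finally show "\<bar>(\<integral>\<omega>. c * f \<omega> * indicator A (T n \<omega>) \<partial>\<mu>) - (\<integral>\<omega>. c * f \<omega> \<partial>\<mu>) * measure \<mu> A\<bar> \<le> e" .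
  qed
qed

lemma mixes_integrable:
  assumes "integrable \<mu> f"
  shows "mixes f"
  using assms
proof (induction rule: integrable_induct)
  case (base A c)
  have "mixes (\<lambda>\<omega>. c * indicator A \<omega>)"
    using base by (intro mixes_scale mixes_indicator)
  then show ?case
    by (simp add: mult.commute)
next
  case (add f g)
  have "mixes (\<lambda>\<omega>. f \<omega> - (- 1) * g \<omega>)"
    using add by (intro mixes_diff mixes_scale) auto
  then show ?case
    by simp
next
  \<comment> \<open>The induction rule bounds the approximating simple functions by twice the
    modulus of their limit.\<close>
  case (lim f s)
  then show ?case
    by (intro mixes_lim[of s f "\<lambda>\<omega>. 2 * \<bar>f \<omega>\<bar>"]) auto
qed

text \<open>The L1 distance to the mean c can be read off from two sets: the whole group, over which
  k n - c integrates to 0, and the set where k n exceeds c. The latter moves with n, which is why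
  mixing has to be uniform in the set.\<close>

lemma L1_convergence_to_mean:
  fixes h :: "('g \<Rightarrow> complex) \<Rightarrow> real" and k :: "nat \<Rightarrow> ('g \<Rightarrow> complex) \<Rightarrow> real"
  assumes h: "integrable \<mu> h" and hn: "\<And>n. integrable \<mu> (k n)"
    and eq: "\<And>n A. A \<in> sets \<mu> \<Longrightarrow>
      (\<integral>\<omega>. h \<omega> * indicator A (T n \<omega>) \<partial>\<mu>) = (\<integral>\<omega>. k n \<omega> * indicator A \<omega> \<partial>\<mu>)"
  shows "(\<lambda>n. \<integral>\<omega>. \<bar>k n \<omega> - (\<integral>\<omega>. h \<omega> \<partial>\<mu>)\<bar> \<partial>\<mu>) \<longlonglongrightarrow> 0"
proof (rule LIMSEQ_I)
  fix e :: real assume e: "e > 0"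
  define c where "c = (\<integral>\<omega>. h \<omega> \<partial>\<mu>)"
  obtain N where N: "\<forall>n\<ge>N. \<forall>A\<in>sets \<mu>.
      \<bar>(\<integral>\<omega>. h \<omega> * indicator A (T n \<omega>) \<partial>\<mu>) - c * measure \<mu> A\<bar> \<le> e / 3"
    unfolding c_def using mixesD[OF mixes_integrable[OF h] divide_pos_pos[OF e zero_less_numeral]] by (rule exE)
  have "norm ((\<integral>\<omega>. \<bar>k n \<omega> - c\<bar> \<partial>\<mu>) - 0) < e" if n: "n \<ge> N" for n
  proof -
    have [measurable]: "k n \<in> borel_measurable \<mu>"
      using hn by auto
    define A where "A = {\<omega> \<in> space \<mu>. k n \<omega> > c}"
    have A: "A \<in> sets \<mu>" "dual_group \<in> sets \<mu>"
      unfolding A_def using sets.top[of \<mu>] by simp_all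
    have int: "integrable \<mu> (\<lambda>\<omega>. k n \<omega> * indicator B \<omega>)" if "B \<in> sets \<mu>" for B
      using integrable_real_mult_indicator[OF that hn[of n]] by (simp add: mult.commute)
    have diff: "(\<integral>\<omega>. (k n \<omega> - c) * indicator B \<omega> \<partial>\<mu>) =
        (\<integral>\<omega>. h \<omega> * indicator B (T n \<omega>) \<partial>\<mu>) - c * measure \<mu> B"
      and intd: "integrable \<mu> (\<lambda>\<omega>. (k n \<omega> - c) * indicator B \<omega>)" if B: "B \<in> sets \<mu>" for B
    proof -
      have i2: "integrable \<mu> (\<lambda>\<omega>. c * indicator B \<omega>)"
        by (rule integrable_bounded_real[of _ "\<bar>c\<bar>"]) (use B in \<open>auto simp: indicator_def\<close>)
      show "(\<integral>\<omega>. (k n \<omega> - c) * indicator B \<omega> \<partial>\<mu>) =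
        (\<integral>\<omega>. h \<omega> * indicator B (T n \<omega>) \<partial>\<mu>) - c * measure \<mu> B"
        using int[OF B] i2 B sets.sets_into_space[OF B] by (simp add: eq left_diff_distrib Int_absorb2)
      show "integrable \<mu> (\<lambda>\<omega>. (k n \<omega> - c) * indicator B \<omega>)"
        using int[OF B] i2 by (simp add: left_diff_distrib)
    qed
    \<comment> \<open>The modulus of u is twice its positive part minus u, here with u = k n
      \<omega> - c. The bound is then 2 * e / 3 < e.\<close>
    have "(\<integral>\<omega>. \<bar>k n \<omega> - c\<bar> \<partial>\<mu>) =
        (\<integral>\<omega>. 2 * ((k n \<omega> - c) * indicator A \<omega>) - (k n \<omega> - c) * indicator dual_group \<omega> \<partial>\<mu>)"
      by (rule Bochner_Integration.integral_cong) (auto simp: A_def indicator_def)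
    also have "\<dots> = 2 * (\<integral>\<omega>. (k n \<omega> - c) * indicator A \<omega> \<partial>\<mu>) -
        (\<integral>\<omega>. (k n \<omega> - c) * indicator dual_group \<omega> \<partial>\<mu>)"
      using intd A by (subst Bochner_Integration.integral_diff) auto
    also have "(\<integral>\<omega>. (k n \<omega> - c) * indicator dual_group \<omega> \<partial>\<mu>) = 0"
    proof -
      have "(\<integral>\<omega>. h \<omega> * indicator dual_group (T n \<omega>) \<partial>\<mu>) = (\<integral>\<omega>. h \<omega> \<partial>\<mu>)"
        by (rule Bochner_Integration.integral_cong) (auto simp: T_in)
      then show ?thesis
        using diff[OF A(2)] by (simp add: c_def)
    qed
    finally show ?thesis
      using N[rule_format, OF n A(1)] e unfolding diff[OF A(1)] by (simp add: abs_if split: if_splits)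
  qed
  then show "\<exists>N. \<forall>n\<ge>N. norm ((\<integral>\<omega>. \<bar>k n \<omega> - (\<integral>\<omega>. h \<omega> \<partial>\<mu>)\<bar> \<partial>\<mu>) - 0) < e"
    unfolding c_def by blast
qed

end

section \<open>Fibre norms and the localized isometry property\<close>

lemma bij_betw_Suc_atLeast_1: "bij_betw Suc UNIV {1..}"
  by (rule bij_betwI[of _ _ _ "\<lambda>i. i - 1"]) auto

lemma summable_on_atLeast_1_iff:
  fixes g :: "nat \<Rightarrow> real"
  assumes "\<And>i. 0 \<le> g i"
  shows "g summable_on {1..} \<longleftrightarrow> summable (\<lambda>i. g (Suc i))"
  using summable_on_reindex_bij_betw[OF bij_betw_Suc_atLeast_1, of g]
    summable_on_UNIV_nonneg_real_iff[of "\<lambda>i. g (Suc i)"] assms by simp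

text \<open>The equation survives divergence because the defaults coincide: \<open>infsum\<close> is
  0 on a family that is not summable, and \<open>enn2real\<close> sends infinity to 0. Measurability
  and Tonelli thus become available for \<open>fibre_sq\<close>.\<close>

lemma infsum_atLeast_1_eq_enn2real:
  fixes g :: "nat \<Rightarrow> real"
  assumes nn: "\<And>i. 0 \<le> g i"
  shows "infsum g {1..} = enn2real (\<Sum>i. ennreal (g (Suc i)))"
proof (cases "summable (\<lambda>i. g (Suc i))")
  case True
  then have "((\<lambda>i. g (Suc i)) has_sum (\<Sum>i. g (Suc i))) UNIV"
    using nn by (intro sums_nonneg_imp_has_sum summable_sums)
  then have "infsum g {1..} = (\<Sum>i. g (Suc i))"
    using infsum_reindex_bij_betw[OF bij_betw_Suc_atLeast_1, of g] by (simp add: infsumI)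
  moreover have "(\<Sum>i. ennreal (g (Suc i))) = ennreal (\<Sum>i. g (Suc i))"
    using nn True by (simp add: suminf_ennreal2)
  ultimately show ?thesis
    using nn True by (simp add: suminf_nonneg)
next
  case False
  then have "\<not> g summable_on {1..}"
    using summable_on_atLeast_1_iff[of g] nn by simp
  moreover have "(\<Sum>i. ennreal (g (Suc i))) = top"
    using summable_suminf_not_top[of "\<lambda>i. g (Suc i)"] nn False by blast
  ultimately show ?thesis
    by (simp add: infsum_not_exists)
qed

definition fibre_sq :: "(nat \<Rightarrow> ('g \<Rightarrow> complex) \<Rightarrow> complex) \<Rightarrow> ('g \<Rightarrow> complex) \<Rightarrow> real" where
  "fibre_sq f \<omega> = (\<Sum>\<^sub>\<infinity>i\<in>{1..}. (cmod (f i \<omega>))\<^sup>2)"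

lemma fibre_norm_eq: "fibre_norm f \<omega> = sqrt (fibre_sq f \<omega>)"
  by (simp add: fibre_norm_def fibre_sq_def)

lemma fibre_sq_nonneg: "0 \<le> fibre_sq f \<omega>"
  unfolding fibre_sq_def by (rule infsum_nonneg) simp

lemma L2_sumD:
  assumes "f \<in> L2_sum \<mu> m" "i \<ge> 1"
  shows "f i \<in> borel_measurable \<mu>" "integrable \<mu> (\<lambda>\<omega>. (cmod (f i \<omega>))\<^sup>2)"
    "\<And>\<omega>. \<omega> \<in> dual_group \<Longrightarrow> \<omega> \<notin> level_set m i \<Longrightarrow> f i \<omega> = 0"
  using assms unfolding L2_sum_def by auto

lemma L2_sum_summable:
  "f \<in> L2_sum \<mu> m \<Longrightarrow> (\<lambda>i. \<integral>\<omega>. (cmod (f i \<omega>))\<^sup>2 \<partial>\<mu>) summable_on {1..}"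
  unfolding L2_sum_def by auto

lemma L2_sum_dominated:
  assumes meas: "\<And>i. i \<ge> 1 \<Longrightarrow> f i \<in> borel_measurable \<mu>"
    and supp: "\<And>i \<omega>. i \<ge> 1 \<Longrightarrow> \<omega> \<in> dual_group \<Longrightarrow> \<omega> \<notin> level_set m i \<Longrightarrow> f i \<omega> = 0"
    and int: "\<And>i. i \<ge> 1 \<Longrightarrow> integrable \<mu> (b i)"
    and sum: "(\<lambda>i. \<integral>\<omega>. b i \<omega> \<partial>\<mu>) summable_on {1..}"
    and le: "\<And>i \<omega>. i \<ge> 1 \<Longrightarrow> (cmod (f i \<omega>))\<^sup>2 \<le> b i \<omega>"
  shows "f \<in> L2_sum \<mu> m"
proof -
  have int': "integrable \<mu> (\<lambda>\<omega>. (cmod (f i \<omega>))\<^sup>2)" if "i \<ge> 1" for i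
  proof (rule Bochner_Integration.integrable_bound[OF int[OF that]])
    show "(\<lambda>\<omega>. (cmod (f i \<omega>))\<^sup>2) \<in> borel_measurable \<mu>"
      using meas[OF that] by measurable
    show "AE \<omega> in \<mu>. norm ((cmod (f i \<omega>))\<^sup>2) \<le> norm (b i \<omega>)"
      using le[OF that] by (intro AE_I2) (simp add: abs_le_iff order_trans[OF _ abs_ge_self])
  qed
  have "(\<lambda>i. \<integral>\<omega>. (cmod (f i \<omega>))\<^sup>2 \<partial>\<mu>) summable_on {1..}"
  proof (rule summable_on_comparison_test[OF sum])
    fix i :: nat assume "i \<in> {1..}"
    then show "(\<integral>\<omega>. (cmod (f i \<omega>))\<^sup>2 \<partial>\<mu>) \<le> (\<integral>\<omega>. b i \<omega> \<partial>\<mu>)"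
      using int int' le by (intro integral_mono) auto
  qed simp
  then show ?thesis
    unfolding L2_sum_def using meas supp int' by auto
qed

lemma L2_sum_add:
  assumes f: "f \<in> L2_sum \<mu> m" and g: "g \<in> L2_sum \<mu> m"
  shows "(\<lambda>i \<omega>. f i \<omega> + g i \<omega>) \<in> L2_sum \<mu> m"
proof (rule L2_sum_dominated[of _ _ _ "\<lambda>i \<omega>. 2 * (cmod (f i \<omega>))\<^sup>2 + 2 * (cmod (g i \<omega>))\<^sup>2"])
  have "(\<lambda>i. 2 * (\<integral>\<omega>. (cmod (f i \<omega>))\<^sup>2 \<partial>\<mu>) + 2 * (\<integral>\<omega>. (cmod (g i \<omega>))\<^sup>2 \<partial>\<mu>)) summable_on {1..}"
    by (intro summable_on_add summable_on_cmult_right L2_sum_summable[OF f] L2_sum_summable[OF g])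
  then show "(\<lambda>i. \<integral>\<omega>. 2 * (cmod (f i \<omega>))\<^sup>2 + 2 * (cmod (g i \<omega>))\<^sup>2 \<partial>\<mu>) summable_on {1..}"
    by (rule summable_on_cong[THEN iffD1, rotated]) (simp add: L2_sumD[OF f] L2_sumD[OF g])
  show "(cmod (f i \<omega> + g i \<omega>))\<^sup>2 \<le> 2 * (cmod (f i \<omega>))\<^sup>2 + 2 * (cmod (g i \<omega>))\<^sup>2" for i \<omega>
  proof -
    have "(cmod (f i \<omega> + g i \<omega>))\<^sup>2 \<le> (cmod (f i \<omega>) + cmod (g i \<omega>))\<^sup>2"
      by (intro power_mono norm_triangle_ineq) simp
    also have "\<dots> \<le> 2 * (cmod (f i \<omega>))\<^sup>2 + 2 * (cmod (g i \<omega>))\<^sup>2"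
      using zero_le_power2[of "cmod (f i \<omega>) - cmod (g i \<omega>)"]
      by (simp add: power2_sum power2_diff)
    finally show ?thesis .
  qed
  show "(\<lambda>\<omega>. f i \<omega> + g i \<omega>) \<in> borel_measurable \<mu>" if "i \<ge> 1" for i
    using L2_sumD(1)[OF f that] L2_sumD(1)[OF g that] by measurable
  show "integrable \<mu> (\<lambda>\<omega>. 2 * (cmod (f i \<omega>))\<^sup>2 + 2 * (cmod (g i \<omega>))\<^sup>2)" if "i \<ge> 1" for i
    using L2_sumD(2)[OF f that] L2_sumD(2)[OF g that] by simp
qed (simp add: L2_sumD(3)[OF f] L2_sumD(3)[OF g])

lemma L2_sum_scale:
  assumes f: "f \<in> L2_sum \<mu> m"
  shows "(\<lambda>i \<omega>. c * f i \<omega>) \<in> L2_sum \<mu> m"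
proof (rule L2_sum_dominated[of _ _ _ "\<lambda>i \<omega>. (cmod c)\<^sup>2 * (cmod (f i \<omega>))\<^sup>2"])
  show "(\<lambda>i. \<integral>\<omega>. (cmod c)\<^sup>2 * (cmod (f i \<omega>))\<^sup>2 \<partial>\<mu>) summable_on {1..}"
    using summable_on_cmult_right[OF L2_sum_summable[OF f]] by simp
  show "(\<lambda>\<omega>. c * f i \<omega>) \<in> borel_measurable \<mu>" if "i \<ge> 1" for i
    using L2_sumD(1)[OF f that] by measurable
qed (simp_all add: L2_sumD[OF f] norm_mult power_mult_distrib)

lemma L2_sum_restrict:
  assumes f: "f \<in> L2_sum \<mu> m" and A: "A \<in> sets \<mu>"
  shows "(\<lambda>i \<omega>. indicator A \<omega> * f i \<omega>) \<in> L2_sum \<mu> m"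
proof (rule L2_sum_dominated[of _ _ _ "\<lambda>i \<omega>. (cmod (f i \<omega>))\<^sup>2"])
  show "(\<lambda>\<omega>. indicator A \<omega> * f i \<omega>) \<in> borel_measurable \<mu>" if "i \<ge> 1" for i
    using L2_sumD(1)[OF f that] A by measurable
  show "(\<lambda>i. \<integral>\<omega>. (cmod (f i \<omega>))\<^sup>2 \<partial>\<mu>) summable_on {1..}"
    by (rule L2_sum_summable[OF f])
qed (simp_all add: L2_sumD[OF f] indicator_def)

lemma L2_sum_zero: "(\<lambda>i \<omega>. 0) \<in> L2_sum \<mu> m"
  by (rule L2_sum_dominated[of _ _ _ "\<lambda>i \<omega>. 0"]) auto

lemma L2_eq_refl: "L2_eq \<mu> f f"
  by (simp add: L2_eq_def)

lemma L2_eq_sym: "L2_eq \<mu> f g \<Longrightarrow> L2_eq \<mu> g f"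
  unfolding L2_eq_def by (simp only: eq_commute)

lemma L2_eq_trans:
  assumes "L2_eq \<mu> f g" "L2_eq \<mu> g h"
  shows "L2_eq \<mu> f h"
  unfolding L2_eq_def
proof
  fix i :: nat assume "i \<in> {1..}"
  then have "AE \<omega> in \<mu>. f i \<omega> = g i \<omega>" "AE \<omega> in \<mu>. g i \<omega> = h i \<omega>"
    using assms unfolding L2_eq_def by auto
  then show "AE \<omega> in \<mu>. f i \<omega> = h i \<omega>"
    by eventually_elim simp
qed

lemma L2_eq_add:
  assumes "L2_eq \<mu> f f'" "L2_eq \<mu> g g'"
  shows "L2_eq \<mu> (\<lambda>i \<omega>. f i \<omega> + g i \<omega>) (\<lambda>i \<omega>. f' i \<omega> + g' i \<omega>)"
  unfolding L2_eq_def
proof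
  fix i :: nat assume "i \<in> {1..}"
  then have "AE \<omega> in \<mu>. f i \<omega> = f' i \<omega>" "AE \<omega> in \<mu>. g i \<omega> = g' i \<omega>"
    using assms unfolding L2_eq_def by auto
  then show "AE \<omega> in \<mu>. f i \<omega> + g i \<omega> = f' i \<omega> + g' i \<omega>"
    by eventually_elim simp
qed

lemma L2_eq_scale: "L2_eq \<mu> f g \<Longrightarrow> L2_eq \<mu> (\<lambda>i \<omega>. c * f i \<omega>) (\<lambda>i \<omega>. c * g i \<omega>)"
  unfolding L2_eq_def by (auto elim: eventually_mono)

text \<open>There are countably many indices, so their exceptional null sets can be united.\<close>

lemma L2_eq_AE: "L2_eq \<mu> f g \<longleftrightarrow> (AE \<omega> in \<mu>. \<forall>i\<in>{1..}. f i \<omega> = g i \<omega>)"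
  unfolding L2_eq_def by (subst AE_ball_countable) auto

lemma L2_eq_fibre_sq:
  assumes "L2_eq \<mu> f g"
  shows "AE \<omega> in \<mu>. fibre_sq f \<omega> = fibre_sq g \<omega>"
  using assms unfolding L2_eq_AE
  by (rule eventually_mono) (auto simp: fibre_sq_def intro!: infsum_cong)

text \<open>Tonelli, carried out in \<open>ennreal\<close>. Where the series of a fibre diverges,
  \<open>fibre_sq\<close> has the default value 0; finiteness of the total integral confines such
  points to a null set.\<close>

lemma
  assumes f: "f \<in> L2_sum \<mu> m"
  shows integrable_fibre_sq: "integrable \<mu> (fibre_sq f)"
    and integral_fibre_sq: "(\<integral>\<omega>. fibre_sq f \<omega> \<partial>\<mu>) = (L2_norm \<mu> f)\<^sup>2"
    and AE_fibre_summable: "AE \<omega> in \<mu>. (\<lambda>i. (cmod (f i \<omega>))\<^sup>2) summable_on {1..}"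
proof -
  let ?e = "\<lambda>\<omega>. \<Sum>i. ennreal ((cmod (f (Suc i) \<omega>))\<^sup>2)"
  let ?I = "\<lambda>i. \<integral>\<omega>. (cmod (f i \<omega>))\<^sup>2 \<partial>\<mu>"
  have [measurable]: "f (Suc i) \<in> borel_measurable \<mu>" for i
    using L2_sumD(1)[OF f] by simp
  have sq: "fibre_sq f = (\<lambda>\<omega>. enn2real (?e \<omega>))"
    unfolding fibre_sq_def by (intro ext infsum_atLeast_1_eq_enn2real) simp
  have I: "summable (\<lambda>i. ?I (Suc i))"
    using L2_sum_summable[OF f] by (subst (asm) summable_on_atLeast_1_iff) auto
  have "(\<integral>\<^sup>+\<omega>. ?e \<omega> \<partial>\<mu>) = (\<Sum>i. \<integral>\<^sup>+\<omega>. ennreal ((cmod (f (Suc i) \<omega>))\<^sup>2) \<partial>\<mu>)"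
    by (rule nn_integral_suminf) measurable
  also have "\<dots> = (\<Sum>i. ennreal (?I (Suc i)))"
    by (intro suminf_cong nn_integral_eq_integral L2_sumD[OF f]) auto
  finally have e: "(\<integral>\<^sup>+\<omega>. ?e \<omega> \<partial>\<mu>) = (\<Sum>i. ennreal (?I (Suc i)))" .
  also have "\<dots> = ennreal (\<Sum>i. ?I (Suc i))"
    using I by (intro suminf_ennreal2) auto
  finally have fin: "(\<integral>\<^sup>+\<omega>. ?e \<omega> \<partial>\<mu>) \<noteq> \<infinity>"
    by simp
  have e_fin: "AE \<omega> in \<mu>. ?e \<omega> \<noteq> \<infinity>"
    using fin by (intro nn_integral_PInf_AE) auto
  then show "AE \<omega> in \<mu>. (\<lambda>i. (cmod (f i \<omega>))\<^sup>2) summable_on {1..}"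
  proof eventually_elim
    fix \<omega> assume "?e \<omega> \<noteq> \<infinity>"
    then show "(\<lambda>i. (cmod (f i \<omega>))\<^sup>2) summable_on {1..}"
      by (subst summable_on_atLeast_1_iff) (auto intro!: summable_suminf_not_top)
  qed
  have nn: "(\<integral>\<^sup>+\<omega>. ennreal (fibre_sq f \<omega>) \<partial>\<mu>) = (\<integral>\<^sup>+\<omega>. ?e \<omega> \<partial>\<mu>)"
    unfolding sq by (rule nn_integral_cong_AE) (use e_fin in \<open>eventually_elim, simp add: less_top\<close>)
  have [measurable]: "fibre_sq f \<in> borel_measurable \<mu>"
    unfolding sq by measurable
  show "integrable \<mu> (fibre_sq f)"
    using fin nn by (intro integrableI_nonneg) (auto simp: fibre_sq_nonneg less_top)
  have "(\<integral>\<omega>. fibre_sq f \<omega> \<partial>\<mu>) = enn2real (\<integral>\<^sup>+\<omega>. ennreal (fibre_sq f \<omega>) \<partial>\<mu>)"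
    by (intro integral_eq_nn_integral) (auto simp: fibre_sq_nonneg)
  also have "\<dots> = infsum ?I {1..}"
    unfolding nn e by (rule infsum_atLeast_1_eq_enn2real[symmetric]) simp
  also have "\<dots> = (L2_norm \<mu> f)\<^sup>2"
    unfolding L2_norm_def by (simp add: infsum_nonneg)
  finally show "(\<integral>\<omega>. fibre_sq f \<omega> \<partial>\<mu>) = (L2_norm \<mu> f)\<^sup>2" .
qed

lemma L2_eq_zero_iff:
  assumes f: "f \<in> L2_sum \<mu> m"
  shows "L2_eq \<mu> f 0 \<longleftrightarrow> (\<integral>\<omega>. fibre_sq f \<omega> \<partial>\<mu>) = 0"
proof
  assume "L2_eq \<mu> f 0"
  then have "AE \<omega> in \<mu>. fibre_sq f \<omega> = 0"
    using L2_eq_fibre_sq[of \<mu> f 0] by (simp add: fibre_sq_def)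
  then show "(\<integral>\<omega>. fibre_sq f \<omega> \<partial>\<mu>) = 0"
    using integral_nonneg_eq_0_iff_AE[OF integrable_fibre_sq[OF f]] fibre_sq_nonneg by auto
next
  assume "(\<integral>\<omega>. fibre_sq f \<omega> \<partial>\<mu>) = 0"
  then have "AE \<omega> in \<mu>. fibre_sq f \<omega> = 0"
    using integral_nonneg_eq_0_iff_AE[OF integrable_fibre_sq[OF f]] fibre_sq_nonneg by auto
  with AE_fibre_summable[OF f] show "L2_eq \<mu> f 0"
    unfolding L2_eq_AE
  proof eventually_elim
    fix \<omega> assume s: "(\<lambda>i. (cmod (f i \<omega>))\<^sup>2) summable_on {1..}" and 0: "fibre_sq f \<omega> = 0"
    show "\<forall>i\<in>{1..}. f i \<omega> = 0 i \<omega>"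
    proof
      fix i :: nat assume "i \<in> {1..}"
      then have "(cmod (f i \<omega>))\<^sup>2 = 0"
        using nonneg_infsum_le_0D[OF _ s, of i] 0 by (simp add: fibre_sq_def)
      then show "f i \<omega> = 0 i \<omega>"
        by simp
    qed
  qed
qed

section \<open>The Ruelle operator modulo null sets and its localization\<close>

locale isometric_ruelle = haar_endo \<mu> \<alpha>
  for \<mu> :: "('g::{ab_group_add, countable} \<Rightarrow> complex) measure" and \<alpha> :: "'g \<Rightarrow> 'g" +
  fixes m :: "('g \<Rightarrow> complex) \<Rightarrow> enat"
    and H :: "nat \<Rightarrow> nat \<Rightarrow> ('g \<Rightarrow> complex) \<Rightarrow> complex"
  assumes ruelle_operator: "is_ruelle_operator \<mu> \<alpha> m H"
    and isometry: "L2_isometry \<mu> m (ruelle \<alpha> H)"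
begin

abbreviation "S \<equiv> ruelle \<alpha> H"
abbreviation "V \<equiv> L2_sum \<mu> m"
abbreviation L2_equiv (infix "\<doteq>" 50) where "f \<doteq> g \<equiv> L2_eq \<mu> f g"

lemma S_in: "f \<in> V \<Longrightarrow> S f \<in> V"
  using isometry by (simp add: L2_isometry_def)

lemma S_pow_in: "f \<in> V \<Longrightarrow> (S ^^ n) f \<in> V"
  by (induction n) (auto intro: S_in)

lemma integral_fibre_sq_S: "f \<in> V \<Longrightarrow> (\<integral>\<omega>. fibre_sq (S f) \<omega> \<partial>\<mu>) = (\<integral>\<omega>. fibre_sq f \<omega> \<partial>\<mu>)"
  using isometry integral_fibre_sq[of f] integral_fibre_sq[OF S_in, of f]
  by (simp add: L2_isometry_def)

text \<open>S evaluates f at \<open>dual_map \<alpha> \<omega>\<close>, so the exceptional null set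
  is pulled back; by invariance of the measure it stays null.\<close>

lemma S_cong:
  assumes "f \<doteq> g"
  shows "S f \<doteq> S g"
proof -
  have "AE \<omega> in \<mu>. \<forall>i\<in>{1..}. f i (dual_map \<alpha> \<omega>) = g i (dual_map \<alpha> \<omega>)"
    using assms unfolding L2_eq_AE by (rule AE_dual_map[OF \<alpha>_add \<alpha>_inj])
  then show ?thesis
    unfolding L2_eq_AE by eventually_elim (auto simp: ruelle_def intro!: infsum_cong)
qed

text \<open>Splitting the series requires convergence of both parts, which is granted almost
  everywhere. A factor independent of the index, in contrast, passes through \<open>infsum\<close>
  even at its default value, so \<open>S_scale\<close> and \<open>S_restrict\<close> are equalities
  of functions.\<close>

lemma S_add:
  assumes f: "f \<in> V" and g: "g \<in> V"
  shows "S (\<lambda>i \<omega>. f i \<omega> + g i \<omega>) \<doteq> (\<lambda>i \<omega>. S f i \<omega> + S g i \<omega>)"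
  unfolding L2_eq_def
proof
  fix j :: nat assume "j \<in> {1..}"
  then have "AE \<omega> in \<mu>. (\<lambda>i. H i j \<omega> * f i (dual_map \<alpha> \<omega>)) summable_on {1..}"
    "AE \<omega> in \<mu>. (\<lambda>i. H i j \<omega> * g i (dual_map \<alpha> \<omega>)) summable_on {1..}"
    using ruelle_operator f g unfolding is_ruelle_operator_def by blast+
  then show "AE \<omega> in \<mu>. S (\<lambda>i \<omega>. f i \<omega> + g i \<omega>) j \<omega> = S f j \<omega> + S g j \<omega>"
    by eventually_elim (simp add: ruelle_def distrib_left infsum_add)
qed

lemma S_scale: "S (\<lambda>i \<omega>. c * f i \<omega>) = (\<lambda>i \<omega>. c * S f i \<omega>)"
proof (intro ext)
  fix j \<omega>
  have "(\<Sum>\<^sub>\<infinity>i\<in>{1..}. H i j \<omega> * (c * f i (dual_map \<alpha> \<omega>))) =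
      (\<Sum>\<^sub>\<infinity>i\<in>{1..}. c * (H i j \<omega> * f i (dual_map \<alpha> \<omega>)))"
    by (intro infsum_cong) (simp add: mult.left_commute)
  then show "S (\<lambda>i \<omega>. c * f i \<omega>) j \<omega> = c * S f j \<omega>"
    by (simp add: ruelle_def infsum_cmult_right')
qed

lemma S_restrict:
  "S (\<lambda>i \<omega>. indicator A \<omega> * f i \<omega>) = (\<lambda>i \<omega>. indicator A (dual_map \<alpha> \<omega>) * S f i \<omega>)"
proof (intro ext)
  fix j \<omega>
  have "(\<Sum>\<^sub>\<infinity>i\<in>{1..}. H i j \<omega> * (indicator A (dual_map \<alpha> \<omega>) * f i (dual_map \<alpha> \<omega>))) =
      (\<Sum>\<^sub>\<infinity>i\<in>{1..}. indicator A (dual_map \<alpha> \<omega>) * (H i j \<omega> * f i (dual_map \<alpha> \<omega>)))"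
    by (intro infsum_cong) (simp add: mult.left_commute)
  then show "S (\<lambda>i \<omega>. indicator A \<omega> * f i \<omega>) j \<omega> = indicator A (dual_map \<alpha> \<omega>) * S f j \<omega>"
    by (simp add: ruelle_def infsum_cmult_right')
qed

lemma L2_eq_iff_diff: "f \<doteq> g \<longleftrightarrow> (\<lambda>i \<omega>. f i \<omega> - g i \<omega>) \<doteq> 0"
  by (simp add: L2_eq_def)

lemma S_pow_cong: "f \<doteq> g \<Longrightarrow> (S ^^ n) f \<doteq> (S ^^ n) g"
  by (induction n) (auto intro: S_cong)

text \<open>Applying the isometry property to \<open>\<chi>\<^sub>A f\<close> localizes it to \<open>A\<close>.\<close>

lemma integral_fibre_sq_S_restrict:
  assumes f: "f \<in> V" and A: "A \<in> sets \<mu>"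
  shows "(\<integral>\<omega>. fibre_sq (S f) \<omega> * indicator A (dual_map \<alpha> \<omega>) \<partial>\<mu>) =
    (\<integral>\<omega>. fibre_sq f \<omega> * indicator A \<omega> \<partial>\<mu>)"
proof -
  have sq: "fibre_sq (\<lambda>i \<omega>. indicator A (t \<omega>) * g i \<omega>) \<omega> = fibre_sq g \<omega> * indicator A (t \<omega>)" for g t \<omega>
    by (cases "t \<omega> \<in> A") (simp_all add: fibre_sq_def)
  show ?thesis
    using integral_fibre_sq_S[OF L2_sum_restrict[OF f A]] unfolding S_restrict sq[of "dual_map \<alpha>"] sq[of "\<lambda>\<omega>. \<omega>"] .
qed

lemma integral_fibre_sq_S_pow_restrict:
  assumes f: "f \<in> V" and A: "A \<in> sets \<mu>"
  shows "(\<integral>\<omega>. fibre_sq ((S ^^ n) f) \<omega> * indicator A (T n \<omega>) \<partial>\<mu>) =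
    (\<integral>\<omega>. fibre_sq f \<omega> * indicator A \<omega> \<partial>\<mu>)"
proof (induction n)
  case 0
  show ?case
    by (simp add: dual_map_def)
next
  case (Suc n)
  \<comment> \<open>The localized isometry removes the outermost S, the set in question being A
    pulled back n times; the induction hypothesis removes the other n factors.\<close>
  let ?B = "T n -` A \<inter> space \<mu>"
  have T_Suc: "T (Suc n) \<omega> = T n (dual_map \<alpha> \<omega>)" for \<omega>
    by (simp add: dual_map_def)
  have "(\<integral>\<omega>. fibre_sq ((S ^^ Suc n) f) \<omega> * indicator A (T (Suc n) \<omega>) \<partial>\<mu>) =
      (\<integral>\<omega>. fibre_sq (S ((S ^^ n) f)) \<omega> * indicator ?B (dual_map \<alpha> \<omega>) \<partial>\<mu>)"
    by (rule Bochner_Integration.integral_cong)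
      (auto simp: T_Suc indicator_def dual_map_in_dual_group[OF \<alpha>_add] simp del: funpow.simps(2),
       simp_all)
  also have "\<dots> = (\<integral>\<omega>. fibre_sq ((S ^^ n) f) \<omega> * indicator ?B \<omega> \<partial>\<mu>)"
    by (rule integral_fibre_sq_S_restrict[OF S_pow_in[OF f] measurable_sets[OF measurable_T A]])
  also have "\<dots> = (\<integral>\<omega>. fibre_sq ((S ^^ n) f) \<omega> * indicator A (T n \<omega>) \<partial>\<mu>)"
    by (rule Bochner_Integration.integral_cong) (auto simp: indicator_def)
  also have "\<dots> = (\<integral>\<omega>. fibre_sq f \<omega> * indicator A \<omega> \<partial>\<mu>)"
    by (rule Suc.IH)
  finally show ?case .
qed

text \<open>The localized isometry for \<open>g n\<close>, read through f = S^n (g n), is the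
  hypothesis of \<open>L1_convergence_to_mean\<close>. The preimages may be chosen independently for
  each n.\<close>

lemma fibre_sq_preimages_L1:
  assumes f: "f \<in> V" and g: "\<And>n. g n \<in> V" "\<And>n. f \<doteq> (S ^^ n) (g n)"
  shows "(\<lambda>n. \<integral>\<omega>. \<bar>fibre_sq (g n) \<omega> - (\<integral>\<omega>. fibre_sq f \<omega> \<partial>\<mu>)\<bar> \<partial>\<mu>) \<longlonglongrightarrow> 0"
proof (rule L1_convergence_to_mean)
  fix n A assume A: "A \<in> sets \<mu>"
  have [measurable]: "fibre_sq f \<in> borel_measurable \<mu>" "fibre_sq ((S ^^ n) (g n)) \<in> borel_measurable \<mu>"
    using integrable_fibre_sq[OF f] integrable_fibre_sq[OF S_pow_in[OF g(1)]] by auto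
  have "(\<integral>\<omega>. fibre_sq f \<omega> * indicator A (T n \<omega>) \<partial>\<mu>) =
      (\<integral>\<omega>. fibre_sq ((S ^^ n) (g n)) \<omega> * indicator A (T n \<omega>) \<partial>\<mu>)"
  proof (rule integral_cong_AE)
    show "AE \<omega> in \<mu>. fibre_sq f \<omega> * indicator A (T n \<omega>) =
        fibre_sq ((S ^^ n) (g n)) \<omega> * indicator A (T n \<omega>)"
      using L2_eq_fibre_sq[OF g(2)[of n]] by eventually_elim simp
  qed (use A in measurable)
  then show "(\<integral>\<omega>. fibre_sq f \<omega> * indicator A (T n \<omega>) \<partial>\<mu>) =
      (\<integral>\<omega>. fibre_sq (g n) \<omega> * indicator A \<omega> \<partial>\<mu>)"
    using integral_fibre_sq_S_pow_restrict[OF g(1) A] by simp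
qed (use integrable_fibre_sq[OF f] integrable_fibre_sq[OF g(1)] in auto)

end

section \<open>Linear dependence in the unitary part\<close>

text \<open>Gaussian elimination, one equation at a time: a vector with a nonzero entry at j is the
  pivot and is used up together with equation j.\<close>

lemma underdetermined_system_solution:
  fixes x :: "'k \<Rightarrow> 'i \<Rightarrow> 'a::field"
  assumes "finite I" "finite K" "card I < card K"
  shows "\<exists>a. (\<exists>k\<in>K. a k \<noteq> 0) \<and> (\<forall>i\<in>I. (\<Sum>k\<in>K. a k * x k i) = 0)"
  using assms
proof (induction I arbitrary: K x rule: finite_induct)
  case empty
  then show ?case
    by (intro exI[of _ "\<lambda>_. 1"]) (auto simp: card_gt_0_iff)
next
  case (insert j I)
  show ?case
  proof (cases "\<forall>k\<in>K. x k j = 0")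
    case True
    obtain a where "\<exists>k\<in>K. a k \<noteq> 0" "\<forall>i\<in>I. (\<Sum>k\<in>K. a k * x k i) = 0"
      using insert.IH[of K x] insert.prems insert.hyps by auto
    then show ?thesis
      using True by (intro exI[of _ a]) auto
  next
    case False
    then obtain p where p: "p \<in> K" "x p j \<noteq> 0"
      by blast
    define y where "y k i = x k i - x k j / x p j * x p i" for k i
    have "card I < card (K - {p})"
      using insert.prems insert.hyps p by simp
    then obtain a where a: "\<exists>k\<in>K - {p}. a k \<noteq> 0" "\<forall>i\<in>I. (\<Sum>k\<in>K - {p}. a k * y k i) = 0"
      using insert.IH[of "K - {p}" y] insert.prems by auto
    define s where "s = (\<Sum>k\<in>K - {p}. a k * (x k j / x p j))"
    \<comment> \<open>The coefficient of the pivot is forced by equation j; with this value the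
      remaining equations become those for y.\<close>
    define b where "b = a(p := - s)"
    have split: "(\<Sum>k\<in>K. b k * x k i) = (\<Sum>k\<in>K - {p}. a k * x k i) - s * x p i" for i
      using insert.prems p by (simp add: b_def sum.remove[of K p])
    have y_sum: "(\<Sum>k\<in>K - {p}. a k * y k i) = (\<Sum>k\<in>K - {p}. a k * x k i) - s * x p i" for i
      by (simp add: y_def s_def right_diff_distrib sum_subtractf sum_distrib_right mult.assoc)
    have "(\<Sum>k\<in>K - {p}. a k * x k j) = s * x p j"
      using p by (simp add: s_def sum_distrib_right)
    then have "(\<Sum>k\<in>K. b k * x k i) = 0" if "i \<in> insert j I" for i
      using that a(2) split[of i] y_sum[of i] by auto
    moreover have "\<exists>k\<in>K. b k \<noteq> 0"
      using a(1) by (auto simp: b_def)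
    ultimately show ?thesis
      by blast
  qed
qed

text \<open>A compact substitute for projective space: every nonzero vector of d + 1 coefficients
  can be scaled into it by making an entry of largest modulus equal to 1. The entries beyond d are
  merely kept in the unit disc, so that the set is a union of full products.\<close>

definition normalized_coeffs :: "nat \<Rightarrow> (nat \<Rightarrow> complex) set" where
  "normalized_coeffs d = {a. (\<forall>k. cmod (a k) \<le> 1) \<and> (\<exists>k\<le>d. a k = 1)}"

text \<open>The position of the entry 1 gives a finite union; each member is a product of compact
  sets, to which Tychonoff applies.\<close>

lemma compact_normalized_coeffs: "compact (normalized_coeffs d)"
proof -
  have eq: "normalized_coeffs d = (\<Union>k\<in>{..d}. PiE UNIV (\<lambda>j. if j = k then {1} else cball 0 1))"
  proof (rule set_eqI)
    fix a :: "nat \<Rightarrow> complex"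
    have "a \<in> PiE UNIV (\<lambda>j. if j = k then {1} else cball 0 1) \<longleftrightarrow> (\<forall>j. cmod (a j) \<le> 1) \<and> a k = 1" for k
    proof
      assume "a \<in> PiE UNIV (\<lambda>j. if j = k then {1} else cball 0 1)"
      then have a: "a j \<in> (if j = k then {1} else cball 0 1)" for j
        by (rule PiE_mem) simp
      show "(\<forall>j. cmod (a j) \<le> 1) \<and> a k = 1"
      proof (intro conjI allI)
        show "cmod (a j) \<le> 1" for j
          using a[of j] by (cases "j = k") simp_all
      qed (use a[of k] in simp)
    qed (auto simp: PiE_UNIV_domain)
    then show "a \<in> normalized_coeffs d \<longleftrightarrow>
        a \<in> (\<Union>k\<in>{..d}. PiE UNIV (\<lambda>j. if j = k then {1} else cball 0 1))"
      by (simp only: normalized_coeffs_def UN_iff mem_Collect_eq) auto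
  qed
  have "compact (if j = k then {1} else cball 0 1 :: complex set)" for j k :: nat
    by (cases "j = k") simp_all
  then have "compact (PiE UNIV (\<lambda>j. if j = k then {1} else cball 0 1 :: complex set))" for k :: nat
    by (rule compact_Pi_UNIV)
  then show ?thesis
    unfolding eq by (intro compact_UN finite_atMost)
qed

text \<open>There are d equations for the d + 1 unknowns a 0, ..., a d.\<close>

lemma normalized_coeffs_kernel:
  fixes x :: "nat \<Rightarrow> nat \<Rightarrow> complex"
  shows "\<exists>a\<in>normalized_coeffs d. \<forall>i\<in>{1..d}. (\<Sum>k\<le>d. a k * x k i) = 0"
proof -
  obtain a k0 where a: "k0 \<le> d" "a k0 \<noteq> 0" "\<And>i. i \<in> {1..d} \<Longrightarrow> (\<Sum>k\<le>d. a k * x k i) = 0"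
    using underdetermined_system_solution[of "{1..d}" "{..d}" x] by auto
  obtain p where p: "p \<le> d" "\<And>k. k \<le> d \<Longrightarrow> cmod (a k) \<le> cmod (a p)"
  proof -
    have "Max ((\<lambda>k. cmod (a k)) ` {..d}) \<in> (\<lambda>k. cmod (a k)) ` {..d}"
      by (intro Max_in) auto
    then obtain p where "Max ((\<lambda>k. cmod (a k)) ` {..d}) = cmod (a p)" "p \<in> {..d}"
      by (rule imageE)
    moreover have "cmod (a k) \<le> Max ((\<lambda>k. cmod (a k)) ` {..d})" if "k \<le> d" for k
      using that by (intro Max_ge) auto
    ultimately show ?thesis
      using that[of p] by simp
  qed
  have p0: "a p \<noteq> 0"
    using p(2)[OF a(1)] a(2) by auto
  define b where "b k = (if k \<le> d then a k / a p else 0)" for k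
  have "b \<in> normalized_coeffs d"
    using p p0 by (auto simp: normalized_coeffs_def b_def norm_divide divide_le_eq_1)
  moreover have "(\<Sum>k\<le>d. b k * x k i) = 0" if "i \<in> {1..d}" for i
  proof -
    have "(\<Sum>k\<le>d. b k * x k i) = (\<Sum>k\<le>d. a k * x k i) / a p"
      by (simp add: b_def sum_divide_distrib)
    then show ?thesis
      using a(3)[OF that] by simp
  qed
  ultimately show ?thesis
    by blast
qed

definition lin_comb :: "nat \<Rightarrow> (nat \<Rightarrow> complex) \<Rightarrow> (nat \<Rightarrow> nat \<Rightarrow> 'x \<Rightarrow> complex) \<Rightarrow> nat \<Rightarrow> 'x \<Rightarrow> complex" where
  "lin_comb d a F = (\<lambda>i \<omega>. \<Sum>k\<le>d. a k * F k i \<omega>)"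

lemma lin_comb_0: "lin_comb 0 a F = (\<lambda>i \<omega>. a 0 * F 0 i \<omega>)"
  and lin_comb_Suc: "lin_comb (Suc d) a F = (\<lambda>i \<omega>. lin_comb d a F i \<omega> + a (Suc d) * F (Suc d) i \<omega>)"
  by (simp_all add: lin_comb_def)

lemma lin_comb_in:
  assumes "\<And>k. F k \<in> L2_sum \<mu> m"
  shows "lin_comb d a F \<in> L2_sum \<mu> m"
  by (induction d) (simp_all add: lin_comb_0 lin_comb_Suc L2_sum_add L2_sum_scale assms)

lemma lin_comb_cong:
  assumes "\<And>k. L2_eq \<mu> (F k) (G k)"
  shows "L2_eq \<mu> (lin_comb d a F) (lin_comb d a G)"
  by (induction d) (simp_all add: lin_comb_0 lin_comb_Suc L2_eq_add L2_eq_scale assms)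

lemma fibre_sq_finite:
  assumes "\<And>i. i > d \<Longrightarrow> f i \<omega> = 0"
  shows "fibre_sq f \<omega> = (\<Sum>i\<in>{1..d}. (cmod (f i \<omega>))\<^sup>2)"
proof -
  have "fibre_sq f \<omega> = (\<Sum>\<^sub>\<infinity>i\<in>{1..d}. (cmod (f i \<omega>))\<^sup>2)"
    unfolding fibre_sq_def by (rule infsum_cong_neutral) (auto simp: assms)
  then show ?thesis
    by simp
qed

text \<open>Cauchy-Schwarz against the constant 1, with d + 1 the number of summands. It will
  measure the effect of perturbing the coefficients of a combination by at most r.\<close>

lemma norm_sum_mult_sq_le:
  fixes c x :: "nat \<Rightarrow> complex"
  assumes "\<And>k. k \<le> d \<Longrightarrow> cmod (c k) \<le> r"
  shows "(cmod (\<Sum>k\<le>d. c k * x k))\<^sup>2 \<le> (real d + 1) * r\<^sup>2 * (\<Sum>k\<le>d. (cmod (x k))\<^sup>2)"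
proof -
  have r: "0 \<le> r"
    using assms[of 0] norm_ge_zero[of "c 0"] by linarith
  have "cmod (\<Sum>k\<le>d. c k * x k) \<le> (\<Sum>k\<le>d. r * cmod (x k))"
    by (rule order_trans[OF norm_sum sum_mono]) (auto simp: norm_mult intro!: mult_right_mono assms)
  also have "\<dots> = r * (\<Sum>k\<le>d. cmod (x k))"
    by (simp add: sum_distrib_left)
  finally have "(cmod (\<Sum>k\<le>d. c k * x k))\<^sup>2 \<le> (r * (\<Sum>k\<le>d. cmod (x k)))\<^sup>2"
    by (intro power_mono) auto
  also have "\<dots> = r\<^sup>2 * (\<Sum>k\<le>d. cmod (x k))\<^sup>2"
    by (simp add: power_mult_distrib)
  also have "\<dots> \<le> r\<^sup>2 * ((\<Sum>k\<le>d. (cmod (x k))\<^sup>2) * (\<Sum>k\<le>d. 1\<^sup>2))"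
    using Cauchy_Schwarz_ineq_sum[of "\<lambda>k. cmod (x k)" "\<lambda>_. 1" "{..d}"]
    by (intro mult_left_mono) simp_all
  also have "\<dots> = (real d + 1) * r\<^sup>2 * (\<Sum>k\<le>d. (cmod (x k))\<^sup>2)"
    by simp
  finally show ?thesis .
qed

section \<open>Dependence of vectors with preimages of every order\<close>

context isometric_ruelle
begin

lemma S_pow_scale: "(S ^^ n) (\<lambda>i \<omega>. c * f i \<omega>) = (\<lambda>i \<omega>. c * (S ^^ n) f i \<omega>)"
  by (induction n) (simp_all add: S_scale)

lemma S_pow_add:
  assumes "f \<in> V" "g \<in> V"
  shows "(S ^^ n) (\<lambda>i \<omega>. f i \<omega> + g i \<omega>) \<doteq> (\<lambda>i \<omega>. (S ^^ n) f i \<omega> + (S ^^ n) g i \<omega>)"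
proof (induction n)
  case 0
  show ?case
    by (simp add: L2_eq_refl)
next
  case (Suc n)
  have "S ((S ^^ n) (\<lambda>i \<omega>. f i \<omega> + g i \<omega>)) \<doteq> S (\<lambda>i \<omega>. (S ^^ n) f i \<omega> + (S ^^ n) g i \<omega>)"
    by (rule S_cong[OF Suc.IH])
  moreover have "S (\<lambda>i \<omega>. (S ^^ n) f i \<omega> + (S ^^ n) g i \<omega>) \<doteq> (\<lambda>i \<omega>. S ((S ^^ n) f) i \<omega> + S ((S ^^ n) g) i \<omega>)"
    by (rule S_add[OF S_pow_in S_pow_in]) fact+
  ultimately show ?case
    using L2_eq_trans by auto
qed

lemma S_pow_lin_comb:
  assumes F: "\<And>k. F k \<in> V"
  shows "(S ^^ n) (lin_comb d a F) \<doteq> lin_comb d a (\<lambda>k. (S ^^ n) (F k))"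
proof (induction d)
  case 0
  show ?case
    by (simp add: lin_comb_0 S_pow_scale L2_eq_refl)
next
  case (Suc d)
  have "(S ^^ n) (lin_comb (Suc d) a F) \<doteq>
      (\<lambda>i \<omega>. (S ^^ n) (lin_comb d a F) i \<omega> + a (Suc d) * (S ^^ n) (F (Suc d)) i \<omega>)"
    using S_pow_add[OF lin_comb_in[OF F] L2_sum_scale[OF F]] by (simp add: lin_comb_Suc S_pow_scale)
  moreover have "(\<lambda>i \<omega>. (S ^^ n) (lin_comb d a F) i \<omega> + a (Suc d) * (S ^^ n) (F (Suc d)) i \<omega>) \<doteq>
      lin_comb (Suc d) a (\<lambda>k. (S ^^ n) (F k))"
    unfolding lin_comb_Suc by (rule L2_eq_add[OF Suc.IH L2_eq_refl])
  ultimately show ?case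
    by (rule L2_eq_trans)
qed

text \<open>Membership in the intersection of the ranges of all S^n, up to null sets. The case n = 0
  only repeats that f is in V.\<close>

definition has_all_preimages :: "(nat \<Rightarrow> ('g \<Rightarrow> complex) \<Rightarrow> complex) \<Rightarrow> bool" where
  "has_all_preimages f \<longleftrightarrow> f \<in> V \<and> (\<forall>n. \<exists>g\<in>V. f \<doteq> (S ^^ n) g)"

text \<open>
  Suppose no normalized combination of the \<open>F k\<close> vanishes. By compactness a finite net \<open>B\<close> of
  coefficient vectors suffices, and there is a point \<open>\<omega>\<close> of \<open>{m \<le> d}\<close> where the combinations over \<open>B\<close>
  of the \<open>n\<close>-th preimages have almost the right fibre norms. But at \<open>\<omega>\<close> these are \<open>d + 1\<close> vectors in a
  space of dimension at most \<open>d\<close>, so that a combination near one from \<open>B\<close> vanishes there.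
\<close>

lemma preimages_linearly_dependent:
  assumes F: "\<And>k. has_all_preimages (F k)"
    and Y: "{\<omega> \<in> dual_group. m \<omega> \<le> enat d} \<in> sets \<mu>" "measure \<mu> {\<omega> \<in> dual_group. m \<omega> \<le> enat d} > 0"
  shows "\<exists>a\<in>normalized_coeffs d. lin_comb d a F \<doteq> 0"
proof (rule ccontr)
  assume contr: "\<not> (\<exists>a\<in>normalized_coeffs d. lin_comb d a F \<doteq> 0)"
  define Y where "Y = {\<omega> \<in> dual_group. m \<omega> \<le> enat d}"
  have FV: "F k \<in> V" for k
    using F unfolding has_all_preimages_def by blast
  define G where "G n k = (SOME g. g \<in> V \<and> F k \<doteq> (S ^^ n) g)" for n k
  have "G n k \<in> V \<and> F k \<doteq> (S ^^ n) (G n k)" for n k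
    unfolding G_def by (rule someI_ex[of "\<lambda>g. g \<in> V \<and> F k \<doteq> (S ^^ n) g"]) (use F[of k] in \<open>auto simp: has_all_preimages_def\<close>)
  then have GV: "\<And>n k. G n k \<in> V" and FG: "\<And>n k. F k \<doteq> (S ^^ n) (G n k)"
    by auto
  define q where "q f = (\<integral>\<omega>. fibre_sq f \<omega> \<partial>\<mu>)" for f :: "nat \<Rightarrow> ('g \<Rightarrow> complex) \<Rightarrow> complex"
  have q_nonneg: "0 \<le> q f" for f
    unfolding q_def by (simp add: fibre_sq_nonneg)
  have q_pos: "q (lin_comb d a F) > 0" if "a \<in> normalized_coeffs d" for a
    using contr that L2_eq_zero_iff[OF lin_comb_in[OF FV], of d a] q_nonneg[of "lin_comb d a F"]
    unfolding q_def by fastforce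
  \<comment> \<open>Bounds the sum of the squared fibre norms of the preimages at the point \<omega>
    found below, where each of the d + 1 terms exceeds \<open>q (F k)\<close> by at most 1.\<close>
  define M where "M = (\<Sum>k\<le>d. q (F k)) + real (d + 1)"
  have M: "M > 0"
    unfolding M_def using q_nonneg by (simp add: add_nonneg_pos sum_nonneg)
  \<comment> \<open>Chosen so that perturbing the coefficients by less than r a costs at most a
    third of \<open>q (lin_comb d a F)\<close> in \<open>norm_sum_mult_sq_le\<close>.\<close>
  define r where "r a = sqrt (q (lin_comb d a F) / (3 * (real d + 1) * M))" for a
  have r_pos: "r a > 0" if "a \<in> normalized_coeffs d" for a
    unfolding r_def using q_pos[OF that] M by simp
  have r_sq: "(real d + 1) * (r a)\<^sup>2 * M = q (lin_comb d a F) / 3" if "a \<in> normalized_coeffs d" for a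
  proof -
    have "e * (x / (3 * e * M)) * M = x / 3" if "e \<noteq> 0" for e x :: real
      using that M by (simp add: field_simps)
    from this[of "real d + 1" "q (lin_comb d a F)"] show ?thesis
      using q_pos[OF that] M by (simp add: r_def)
  qed
  define U where "U b = {a :: nat \<Rightarrow> complex. \<forall>k\<in>{..d}. cmod (b k - a k) < r b}" for b
  have U_open: "open (U b)" for b
  proof -
    have "U b = (\<Inter>k\<in>{..d}. {a. cmod (b k - a k) < r b})"
      unfolding U_def by auto
    moreover have "open {a :: nat \<Rightarrow> complex. cmod (b k - a k) < r b}" for k
    proof -
      have "open ((\<lambda>a :: nat \<Rightarrow> complex. a k) -` ball (b k) (r b))"
        by (rule open_vimage[OF open_ball continuous_on_product_coordinates])
      then show ?thesis
        by (simp add: vimage_def dist_norm)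
    qed
    ultimately show ?thesis
      by (simp only:) (intro open_INT finite_atMost ballI)
  qed
  have U_cover: "normalized_coeffs d \<subseteq> (\<Union>b\<in>normalized_coeffs d. U b)"
    using r_pos by (auto simp: U_def)
  obtain B where B: "B \<subseteq> normalized_coeffs d" "finite B" "normalized_coeffs d \<subseteq> (\<Union>b\<in>B. U b)"
    by (rule compactE_image[OF compact_normalized_coeffs U_open U_cover])
  \<comment> \<open>Half of q against the third allowed by r yields the contradiction; the entry 1
    justifies the summand d + 1 in M and keeps the set nonempty.\<close>
  define \<delta> where "\<delta> = Min (insert 1 ((\<lambda>b. q (lin_comb d b F) / 2) ` B))"
  have fin: "finite (insert 1 ((\<lambda>b. q (lin_comb d b F) / 2) ` B))"
    using B(2) by simp
  have "\<delta> \<in> insert 1 ((\<lambda>b. q (lin_comb d b F) / 2) ` B)"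
    unfolding \<delta>_def using fin by (intro Min_in) simp_all
  then have \<delta>_pos: "\<delta> > 0"
    using B(1) q_pos by auto
  have \<delta>_le: "\<delta> \<le> 1" "\<And>b. b \<in> B \<Longrightarrow> \<delta> \<le> q (lin_comb d b F) / 2"
    unfolding \<delta>_def by (rule Min_le[OF fin], blast)+
  \<comment> \<open>The total deviation from the limits. Its integral tends to 0 because the net B
    is finite, and one small value of D controls all the combinations at the same point.\<close>
  define D where "D n \<omega> = (\<Sum>b\<in>B. \<bar>fibre_sq (lin_comb d b (G n)) \<omega> - q (lin_comb d b F)\<bar>) +
      (\<Sum>k\<le>d. \<bar>fibre_sq (G n k) \<omega> - q (F k)\<bar>)" for n \<omega>
  have int_lc: "integrable \<mu> (\<lambda>\<omega>. \<bar>fibre_sq (lin_comb d b (G n)) \<omega> - q (lin_comb d b F)\<bar>)" for b n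
    using integrable_fibre_sq[OF lin_comb_in[OF GV]] by simp
  have int_G: "integrable \<mu> (\<lambda>\<omega>. \<bar>fibre_sq (G n k) \<omega> - q (F k)\<bar>)" for k n
    using integrable_fibre_sq[OF GV] by simp
  have int_D: "integrable \<mu> (D n)" for n
    unfolding D_def using int_lc int_G by simp
  have FG': "lin_comb d b F \<doteq> (S ^^ n) (lin_comb d b (G n))" for b n
    by (rule L2_eq_trans[OF lin_comb_cong[OF FG] L2_eq_sym[OF S_pow_lin_comb[OF GV]]])
  have "(\<lambda>n. (\<Sum>b\<in>B. \<integral>\<omega>. \<bar>fibre_sq (lin_comb d b (G n)) \<omega> - q (lin_comb d b F)\<bar> \<partial>\<mu>) +
      (\<Sum>k\<le>d. \<integral>\<omega>. \<bar>fibre_sq (G n k) \<omega> - q (F k)\<bar> \<partial>\<mu>)) \<longlonglongrightarrow> (\<Sum>b\<in>B. 0) + (\<Sum>k\<le>d. 0)"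
    unfolding q_def
    by (intro tendsto_add tendsto_sum fibre_sq_preimages_L1 lin_comb_in FV GV FG FG')
  moreover have "(\<integral>\<omega>. D n \<omega> \<partial>\<mu>) =
      (\<Sum>b\<in>B. \<integral>\<omega>. \<bar>fibre_sq (lin_comb d b (G n)) \<omega> - q (lin_comb d b F)\<bar> \<partial>\<mu>) +
      (\<Sum>k\<le>d. \<integral>\<omega>. \<bar>fibre_sq (G n k) \<omega> - q (F k)\<bar> \<partial>\<mu>)" for n
    unfolding D_def using int_lc int_G by simp
  ultimately have "(\<lambda>n. \<integral>\<omega>. D n \<omega> \<partial>\<mu>) \<longlonglongrightarrow> 0"
    by simp
  moreover have "0 < \<delta> * measure \<mu> Y"
    using \<delta>_pos assms(3) by (simp add: Y_def)
  ultimately have "\<forall>\<^sub>F n in sequentially. (\<integral>\<omega>. D n \<omega> \<partial>\<mu>) < \<delta> * measure \<mu> Y"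
    by (rule order_tendstoD(2))
  then obtain n where n: "(\<integral>\<omega>. D n \<omega> \<partial>\<mu>) < \<delta> * measure \<mu> Y"
    by (meson eventually_happens sequentially_bot)
  have D_nonneg: "0 \<le> D n \<omega>" for \<omega>
    unfolding D_def by (intro add_nonneg_nonneg sum_nonneg) auto
  \<comment> \<open>Markov's inequality: otherwise the integral of D n would be at least \<delta>
    times the measure of Y.\<close>
  have "\<exists>\<omega>\<in>Y. D n \<omega> < \<delta>"
  proof (rule ccontr)
    assume "\<not> (\<exists>\<omega>\<in>Y. D n \<omega> < \<delta>)"
    then have "\<delta> * indicator Y \<omega> \<le> D n \<omega>" for \<omega>
      using D_nonneg[of \<omega>] by (auto simp: indicator_def not_less)
    moreover have "integrable \<mu> (\<lambda>\<omega>. \<delta> * indicator Y \<omega>)"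
      by (rule integrable_bounded_real[of _ "\<bar>\<delta>\<bar>"])
        (use assms(2) in \<open>auto simp: Y_def[symmetric] indicator_def\<close>)
    ultimately have "(\<integral>\<omega>. \<delta> * indicator Y \<omega> \<partial>\<mu>) \<le> (\<integral>\<omega>. D n \<omega> \<partial>\<mu>)"
      using int_D by (intro integral_mono)
    moreover have "Y \<inter> dual_group = Y"
      by (auto simp: Y_def)
    ultimately show False
      using n by simp
  qed
  then obtain \<omega> where \<omega>: "\<omega> \<in> dual_group" "m \<omega> \<le> enat d" "D n \<omega> < \<delta>"
    unfolding Y_def by blast
  have G0: "G n k i \<omega> = 0" if "i > d" for k i
  proof -
    have "\<omega> \<notin> level_set m i"
      using \<omega>(2) that by (auto simp: level_set_def dest: order_trans)
    then show ?thesis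
      using L2_sumD(3)[OF GV, of i \<omega>] \<omega>(1) that by simp
  qed
  have D_ge: "\<bar>fibre_sq (lin_comb d b (G n)) \<omega> - q (lin_comb d b F)\<bar> \<le> D n \<omega>" if "b \<in> B" for b
  proof -
    have "\<bar>fibre_sq (lin_comb d b (G n)) \<omega> - q (lin_comb d b F)\<bar> \<le>
        (\<Sum>b\<in>B. \<bar>fibre_sq (lin_comb d b (G n)) \<omega> - q (lin_comb d b F)\<bar>)"
      using that B(2) by (intro member_le_sum) auto
    moreover have "0 \<le> (\<Sum>k\<le>d. \<bar>fibre_sq (G n k) \<omega> - q (F k)\<bar>)"
      by (intro sum_nonneg) simp
    ultimately show ?thesis
      unfolding D_def by linarith
  qed
  have "(\<Sum>k\<le>d. fibre_sq (G n k) \<omega>) \<le> M"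
  proof -
    have "fibre_sq (G n k) \<omega> \<le> q (F k) + 1" if "k \<le> d" for k
    proof -
      have "\<bar>fibre_sq (G n k) \<omega> - q (F k)\<bar> \<le> (\<Sum>k\<le>d. \<bar>fibre_sq (G n k) \<omega> - q (F k)\<bar>)"
        using that by (intro member_le_sum) auto
      moreover have "0 \<le> (\<Sum>b\<in>B. \<bar>fibre_sq (lin_comb d b (G n)) \<omega> - q (lin_comb d b F)\<bar>)"
        by (intro sum_nonneg) simp
      ultimately show ?thesis
        using \<omega>(3) \<delta>_le(1) unfolding D_def by linarith
    qed
    then have "(\<Sum>k\<le>d. fibre_sq (G n k) \<omega>) \<le> (\<Sum>k\<le>d. q (F k) + 1)"
      by (intro sum_mono) auto
    then show ?thesis
      by (simp add: M_def sum.distrib)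
  qed
  obtain a where a: "a \<in> normalized_coeffs d" "\<And>i. i \<in> {1..d} \<Longrightarrow> (\<Sum>k\<le>d. a k * G n k i \<omega>) = 0"
    using normalized_coeffs_kernel[of d "\<lambda>k i. G n k i \<omega>"] by auto
  obtain b where b: "b \<in> B" "a \<in> U b"
    using a(1) B(3) by blast
  have bn: "b \<in> normalized_coeffs d"
    using b(1) B(1) by blast
  have "fibre_sq (lin_comb d b (G n)) \<omega> = (\<Sum>i\<in>{1..d}. (cmod (\<Sum>k\<le>d. b k * G n k i \<omega>))\<^sup>2)"
    using fibre_sq_finite[of d "lin_comb d b (G n)" \<omega>] by (simp add: lin_comb_def G0)
  \<comment> \<open>Subtracting the vanishing combination with coefficients a leaves coefficients
    smaller than r b. The squared fibre norm is then at most q / 3, while D n \<omega> < \<delta>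
    forces it above q / 2.\<close>
  also have "\<dots> = (\<Sum>i\<in>{1..d}. (cmod (\<Sum>k\<le>d. (b k - a k) * G n k i \<omega>))\<^sup>2)"
    by (intro sum.cong refl) (simp add: left_diff_distrib sum_subtractf a(2))
  also have "\<dots> \<le> (\<Sum>i\<in>{1..d}. (real d + 1) * (r b)\<^sup>2 * (\<Sum>k\<le>d. (cmod (G n k i \<omega>))\<^sup>2))"
    using b(2) by (intro sum_mono norm_sum_mult_sq_le) (auto simp: U_def less_imp_le)
  also have "\<dots> = (real d + 1) * (r b)\<^sup>2 * (\<Sum>k\<le>d. \<Sum>i\<in>{1..d}. (cmod (G n k i \<omega>))\<^sup>2)"
    by (subst sum.swap) (simp add: sum_distrib_left)
  also have "\<dots> = (real d + 1) * (r b)\<^sup>2 * (\<Sum>k\<le>d. fibre_sq (G n k) \<omega>)"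
    by (simp add: fibre_sq_finite[of d] G0)
  also have "\<dots> \<le> (real d + 1) * (r b)\<^sup>2 * M"
    by (intro mult_left_mono) (fact | simp)+
  also have "\<dots> = q (lin_comb d b F) / 3"
    by (rule r_sq[OF bn])
  finally show False
    using D_ge[OF b(1)] \<omega>(3) \<delta>_le(2)[OF b(1)] q_pos[OF bn] by linarith
qed

end

section \<open>Eigenvectors\<close>

lemma fibre_sq_scale: "fibre_sq (\<lambda>i \<omega>. c * f i \<omega>) \<omega> = (cmod c)\<^sup>2 * fibre_sq f \<omega>"
  by (simp add: fibre_sq_def norm_mult power_mult_distrib infsum_cmult_right')

context isometric_ruelle
begin

lemma has_all_preimages_S_pow:
  assumes "has_all_preimages f"
  shows "has_all_preimages ((S ^^ k) f)"
  unfolding has_all_preimages_def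
proof (intro conjI allI)
  show "(S ^^ k) f \<in> V"
    using assms by (simp add: has_all_preimages_def S_pow_in)
  fix n
  obtain g where g: "g \<in> V" "f \<doteq> (S ^^ n) g"
    using assms unfolding has_all_preimages_def by blast
  have "(S ^^ k) f \<doteq> (S ^^ k) ((S ^^ n) g)"
    by (rule S_pow_cong[OF g(2)])
  moreover have "(S ^^ k) ((S ^^ n) g) = (S ^^ n) ((S ^^ k) g)"
    by (metis add.commute comp_apply funpow_add)
  ultimately show "\<exists>g\<in>V. (S ^^ k) f \<doteq> (S ^^ n) g"
    using S_pow_in[OF g(1)] by auto
qed

text \<open>Split off a linear factor, p = (X - c) q, and put w = q(S) v. Then (S - c) w = 0, so
  either w is an eigenvector or q annihilates v in lower degree. A nonzero constant cannot
  annihilate v, so the descent stops at an eigenvector.\<close>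

lemma eigenvector_of_annihilating_poly:
  assumes "p \<noteq> 0" "degree p \<le> n" and v: "v \<in> V" "\<not> v \<doteq> 0"
    and "lin_comb n (coeff p) (\<lambda>k. (S ^^ k) v) \<doteq> 0"
  shows "\<exists>c f. L2_eigenvector \<mu> m S c f"
  using assms(1,2,5)
proof (induction n arbitrary: p)
  case 0
  then have c: "coeff p 0 \<noteq> 0"
    by (metis le_0_eq leading_coeff_0_iff)
  have "(\<lambda>i \<omega>. inverse (coeff p 0) * (coeff p 0 * v i \<omega>)) \<doteq> (\<lambda>i \<omega>. inverse (coeff p 0) * 0 i \<omega>)"
    using "0.prems"(3) by (intro L2_eq_scale) (simp add: lin_comb_0)
  then have "v \<doteq> 0"
    using c by (simp add: mult.assoc[symmetric] L2_eq_def)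
  then show ?case
    using v(2) by blast
next
  case (Suc n)
  show ?case
  proof (cases "degree p \<le> n")
    \<comment> \<open>Here n is only an upper bound: the top coefficient is 0 and the sum loses its
      last term.\<close>
    case True
    then have "coeff p (Suc n) = 0"
      by (simp add: coeff_eq_0)
    then have "lin_comb (Suc n) (coeff p) (\<lambda>k. (S ^^ k) v) = lin_comb n (coeff p) (\<lambda>k. (S ^^ k) v)"
      by (simp add: lin_comb_Suc)
    then show ?thesis
      using Suc.IH[OF Suc.prems(1) True] Suc.prems(3) by simp
  next
    case False
    then have deg: "degree p = Suc n"
      using Suc.prems(2) by simp
    then obtain c where "poly p c = 0"
      using alg_closed_imp_poly_has_root[of p] by auto
    then obtain q where q: "p = [:- c, 1:] * q"
      by (metis poly_eq_0_iff_dvd dvdE)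
    then have q0: "q \<noteq> 0"
      using Suc.prems(1) by auto
    have "degree p = degree [:- c, 1:] + degree q"
      unfolding q by (rule degree_mult_eq) (use q0 in simp_all)
    then have degq: "degree q = n"
      using deg by simp
    define F where "F = (\<lambda>k. (S ^^ k) v)"
    define w where "w = lin_comb n (coeff q) F"
    have FV: "F k \<in> V" for k
      unfolding F_def by (rule S_pow_in[OF v(1)])
    have wV: "w \<in> V"
      unfolding w_def by (rule lin_comb_in[OF FV])
    \<comment> \<open>Coefficients of (X - c) q. Since q has degree n, its coefficient at
      \<open>Suc n\<close> is 0 and the sums over k can be shifted.\<close>
    have p_0: "coeff p 0 = - c * coeff q 0" and p_Suc: "coeff p (Suc k) = coeff q k - c * coeff q (Suc k)" for k
      unfolding q by (simp_all add: mult_pCons_left)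
    have "(\<Sum>k\<le>n. coeff q k * x k) = coeff q 0 * x 0 + (\<Sum>k\<le>n. coeff q (Suc k) * x (Suc k))"
      for x :: "nat \<Rightarrow> complex"
      using sum.atMost_Suc_shift[of "\<lambda>k. coeff q k * x k" n] degq by (simp add: coeff_eq_0)
    then have "(\<Sum>k\<le>Suc n. coeff p k * x k) =
        (\<Sum>k\<le>n. coeff q k * x (Suc k)) - c * (\<Sum>k\<le>n. coeff q k * x k)" for x :: "nat \<Rightarrow> complex"
      unfolding sum.atMost_Suc_shift p_0 p_Suc
      by (simp add: left_diff_distrib sum_subtractf sum_distrib_left algebra_simps)
    then have "lin_comb (Suc n) (coeff p) F =
        (\<lambda>i \<omega>. lin_comb n (coeff q) (\<lambda>k. F (Suc k)) i \<omega> - c * w i \<omega>)"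
      unfolding lin_comb_def w_def by (intro ext)
    then have "lin_comb n (coeff q) (\<lambda>k. F (Suc k)) \<doteq> (\<lambda>i \<omega>. c * w i \<omega>)"
      using Suc.prems(3) unfolding F_def[symmetric] by (simp only: L2_eq_iff_diff[symmetric])
    moreover have "S w \<doteq> lin_comb n (coeff q) (\<lambda>k. F (Suc k))"
      using S_pow_lin_comb[where F = F and n = 1 and d = n and a = "coeff q", OF FV]
      unfolding w_def by (simp add: F_def)
    ultimately have Sw: "S w \<doteq> (\<lambda>i \<omega>. c * w i \<omega>)"
      using L2_eq_trans by blast
    show ?thesis
    proof (cases "w \<doteq> 0")
      case True
      then show ?thesis
        unfolding w_def F_def by (intro Suc.IH[OF q0]) (simp_all only: degq order_refl)
    next
      case False
      then have "L2_eigenvector \<mu> m S c w"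
        using wV Sw by (simp add: L2_eigenvector_def)
      then show ?thesis
        by blast
    qed
  qed
qed

lemma eigenvector_exists:
  assumes f: "has_all_preimages f" "\<not> f \<doteq> 0"
    and m: "m \<in> borel_measurable \<mu>" "emeasure \<mu> {\<omega> \<in> dual_group. m \<omega> \<noteq> \<infinity>} > 0"
  shows "\<exists>c f. L2_eigenvector \<mu> m S c f"
proof -
  define Y where "Y d = {\<omega> \<in> dual_group. m \<omega> \<le> enat d}" for d
  have Y: "Y d \<in> sets \<mu>" for d
  proof -
    have "m -` {..enat d} \<inter> space \<mu> \<in> sets \<mu>"
      by (rule measurable_sets[OF m(1)]) simp
    moreover have "m -` {..enat d} \<inter> space \<mu> = Y d"
      by (auto simp: Y_def)
    ultimately show ?thesis
      by simp
  qed
  \<comment> \<open>The sets Y d exhaust the set where m is finite, so they cannot all be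
    null.\<close>
  have "\<exists>d. measure \<mu> (Y d) > 0"
  proof (rule ccontr)
    assume "\<not> (\<exists>d. measure \<mu> (Y d) > 0)"
    then have "measure \<mu> (Y d) = 0" for d
      by (simp add: not_less measure_le_0_iff)
    then have "Y d \<in> null_sets \<mu>" for d
      using Y by (simp add: null_sets_def emeasure_eq_measure)
    then have "(\<Union>d. Y d) \<in> null_sets \<mu>"
      by (rule null_sets_UN)
    moreover have "(\<Union>d. Y d) = {\<omega> \<in> dual_group. m \<omega> \<noteq> \<infinity>}"
    proof (intro set_eqI iffI)
      fix \<omega> assume "\<omega> \<in> {\<omega> \<in> dual_group. m \<omega> \<noteq> \<infinity>}"
      then show "\<omega> \<in> (\<Union>d. Y d)"
        by (cases "m \<omega>") (auto simp: Y_def)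
    qed (auto simp: Y_def dest: enat_ile)
    ultimately show False
      using m(2) by (simp add: null_sets_def)
  qed
  then obtain d where d: "measure \<mu> (Y d) > 0" ..
  obtain a where a: "a \<in> normalized_coeffs d" "lin_comb d a (\<lambda>k. (S ^^ k) f) \<doteq> 0"
    using preimages_linearly_dependent[where F = "\<lambda>k. (S ^^ k) f", OF has_all_preimages_S_pow[OF f(1)]]
      Y[of d] d unfolding Y_def by blast
  \<comment> \<open>The entries of a beyond d need not vanish, so they are cut off. The entry equal
    to 1 has index at most d, which makes p nonzero.\<close>
  define p where "p = (\<Sum>k\<le>d. monom (a k) k)"
  have coeff_p: "coeff p k = (if k \<le> d then a k else 0)" for k
    by (simp add: p_def coeff_sum)
  have "p \<noteq> 0"
  proof
    assume "p = 0"
    then have "a k = 0" if "k \<le> d" for k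
      using coeff_p[of k] that by simp
    then show False
      using a(1) by (auto simp: normalized_coeffs_def)
  qed
  moreover have "degree p \<le> d"
    by (rule degree_le) (simp add: coeff_p)
  moreover have "lin_comb d (coeff p) (\<lambda>k. (S ^^ k) f) = lin_comb d a (\<lambda>k. (S ^^ k) f)"
    by (simp add: lin_comb_def coeff_p)
  ultimately show ?thesis
    using eigenvector_of_annihilating_poly[of p d f] f a(2) by (simp add: has_all_preimages_def)
qed

lemma eigenvalue_norm:
  assumes "L2_eigenvector \<mu> m S c f"
  shows "cmod c = 1"
proof -
  have f: "f \<in> V" "\<not> f \<doteq> 0" "S f \<doteq> (\<lambda>i \<omega>. c * f i \<omega>)"
    using assms by (simp_all add: L2_eigenvector_def)
  have "(\<integral>\<omega>. fibre_sq f \<omega> \<partial>\<mu>) = (\<integral>\<omega>. fibre_sq (S f) \<omega> \<partial>\<mu>)"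
    by (rule integral_fibre_sq_S[OF f(1), symmetric])
  also have "\<dots> = (\<integral>\<omega>. (cmod c)\<^sup>2 * fibre_sq f \<omega> \<partial>\<mu>)"
  proof (rule integral_cong_AE)
    show "AE \<omega> in \<mu>. fibre_sq (S f) \<omega> = (cmod c)\<^sup>2 * fibre_sq f \<omega>"
      using L2_eq_fibre_sq[OF f(3)] by (simp add: fibre_sq_scale)
  qed (use integrable_fibre_sq[OF f(1)] integrable_fibre_sq[OF S_in[OF f(1)]] in auto)
  also have "\<dots> = (cmod c)\<^sup>2 * (\<integral>\<omega>. fibre_sq f \<omega> \<partial>\<mu>)"
    by simp
  finally have "(cmod c)\<^sup>2 = 1"
    using L2_eq_zero_iff[OF f(1)] f(2) by simp
  then show ?thesis
    using norm_ge_zero[of c] by (simp add: power2_eq_1_iff)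
qed

text \<open>S^n acts on f as c^n, so dividing by c^n gives the preimage. Since c has modulus 1, this
  preimage has the fibre norms of f.\<close>

lemma eigenvector_preimages:
  assumes "L2_eigenvector \<mu> m S c f"
  shows "f \<doteq> (S ^^ n) (\<lambda>i \<omega>. inverse c ^ n * f i \<omega>)"
proof -
  have f: "S f \<doteq> (\<lambda>i \<omega>. c * f i \<omega>)"
    using assms by (simp add: L2_eigenvector_def)
  have c: "c \<noteq> 0"
    using eigenvalue_norm[OF assms] by auto
  have pow: "(S ^^ n) f \<doteq> (\<lambda>i \<omega>. c ^ n * f i \<omega>)"
  proof (induction n)
    case 0
    show ?case
      by (simp add: L2_eq_refl)
  next
    case (Suc n)
    have "S ((S ^^ n) f) \<doteq> (\<lambda>i \<omega>. c ^ n * S f i \<omega>)"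
      using S_cong[OF Suc.IH] by (simp add: S_scale)
    moreover have "(\<lambda>i \<omega>. c ^ n * S f i \<omega>) \<doteq> (\<lambda>i \<omega>. c ^ n * (c * f i \<omega>))"
      by (rule L2_eq_scale[OF f])
    moreover have "(\<lambda>i \<omega>. c ^ n * (c * f i \<omega>)) = (\<lambda>i \<omega>. c ^ Suc n * f i \<omega>)"
      by (simp add: mult_ac)
    ultimately show ?case
      using L2_eq_trans by auto
  qed
  have "(\<lambda>i \<omega>. inverse c ^ n * (S ^^ n) f i \<omega>) \<doteq> (\<lambda>i \<omega>. inverse c ^ n * (c ^ n * f i \<omega>))"
    by (rule L2_eq_scale[OF pow])
  moreover have "inverse c ^ n * (c ^ n * z) = z" for z
    using c by (simp add: mult.assoc[symmetric] power_mult_distrib[symmetric])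
  ultimately show ?thesis
    unfolding S_pow_scale by (simp add: L2_eq_sym)
qed

lemma unit_eigenvector_fibre_norm:
  assumes eig: "L2_eigenvector \<mu> m S c f" and unit: "L2_norm \<mu> f = 1"
  shows "AE \<omega> in \<mu>. fibre_norm f \<omega> = 1"
proof -
  have f: "f \<in> V"
    using eig by (simp add: L2_eigenvector_def)
  have "cmod (inverse c ^ n) = 1" for n
    using eigenvalue_norm[OF eig] by (simp add: norm_power norm_inverse)
  then have sq: "fibre_sq (\<lambda>i \<omega>. inverse c ^ n * f i \<omega>) = fibre_sq f" for n
    by (simp add: fun_eq_iff fibre_sq_scale)
  have one: "(\<integral>\<omega>. fibre_sq f \<omega> \<partial>\<mu>) = 1"
    using integral_fibre_sq[OF f] unit by simp
  have "(\<lambda>n::nat. \<integral>\<omega>. \<bar>fibre_sq f \<omega> - 1\<bar> \<partial>\<mu>) \<longlonglongrightarrow> 0"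
    using fibre_sq_preimages_L1[OF f L2_sum_scale[OF f] eigenvector_preimages[OF eig]]
    unfolding sq one .
  then have "(\<integral>\<omega>. \<bar>fibre_sq f \<omega> - 1\<bar> \<partial>\<mu>) = 0"
    by (simp add: LIMSEQ_const_iff)
  moreover have "integrable \<mu> (\<lambda>\<omega>. \<bar>fibre_sq f \<omega> - 1\<bar>)"
    using integrable_fibre_sq[OF f] by simp
  ultimately have "AE \<omega> in \<mu>. \<bar>fibre_sq f \<omega> - 1\<bar> = 0"
    by (subst (asm) integral_nonneg_eq_0_iff_AE) auto
  then show ?thesis
    by eventually_elim (simp add: fibre_norm_eq)
qed

text \<open>S is an isometry, so purity is decided by the intersection of the ranges.
  Representatives of 0 always belong to it; purity fails exactly when something else does.\<close>

lemma not_pure_iff: "\<not> pure_L2_isometry \<mu> m S \<longleftrightarrow> (\<exists>f. has_all_preimages f \<and> \<not> f \<doteq> 0)"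
proof -
  have "f \<in> (\<Inter>n\<in>{1..}. L2_range \<mu> m (S ^^ n)) \<longleftrightarrow> has_all_preimages f" for f
  proof
    assume f: "f \<in> (\<Inter>n\<in>{1..}. L2_range \<mu> m (S ^^ n))"
    then have "f \<in> L2_range \<mu> m (S ^^ n)" if "n \<ge> 1" for n
      using that by blast
    then have r: "f \<in> V \<and> (\<exists>g\<in>V. f \<doteq> (S ^^ n) g)" if "n \<ge> 1" for n
      using that by (simp add: L2_range_def)
    show "has_all_preimages f"
      unfolding has_all_preimages_def
    proof (intro conjI allI)
      show fV: "f \<in> V"
        using r[of 1] by simp
      show "\<exists>g\<in>V. f \<doteq> (S ^^ n) g" for n
        \<comment> \<open>The intersection starts at n = 1; for n = 0 the vector f is its own
          preimage.\<close>
        by (cases "n = 0") (use fV L2_eq_refl r[of n] in auto)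
    qed
  next
    assume "has_all_preimages f"
    then show "f \<in> (\<Inter>n\<in>{1..}. L2_range \<mu> m (S ^^ n))"
      by (auto simp: L2_range_def has_all_preimages_def)
  qed
  then have Inter: "(\<Inter>n\<in>{1..}. L2_range \<mu> m (S ^^ n)) = {f. has_all_preimages f}"
    by blast
  have zero: "has_all_preimages f" if "f \<in> V" "f \<doteq> 0" for f
    unfolding has_all_preimages_def
  proof (intro conjI allI bexI)
    fix n
    have "(S ^^ n) (\<lambda>i \<omega>. 0) = 0"
      using S_pow_scale[of n 0 0] by (simp add: fun_eq_iff)
    then show "f \<doteq> (S ^^ n) (\<lambda>i \<omega>. 0)"
      using that by simp
  qed (use that L2_sum_zero in auto)
  show ?thesis
    unfolding pure_L2_isometry_def Inter using isometry zero by (auto simp: has_all_preimages_def)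
qed

lemma eigenvector_has_all_preimages:
  assumes "L2_eigenvector \<mu> m S c f"
  shows "has_all_preimages f \<and> \<not> f \<doteq> 0"
  using assms eigenvector_preimages[OF assms] L2_sum_scale
  unfolding has_all_preimages_def L2_eigenvector_def by blast

end

theorem theorem3:
  fixes \<alpha> :: "'g::{ab_group_add, countable} \<Rightarrow> 'g"
    and \<mu> :: "('g \<Rightarrow> complex) measure"
    and m :: "('g \<Rightarrow> complex) \<Rightarrow> enat"
    and H :: "nat \<Rightarrow> nat \<Rightarrow> ('g \<Rightarrow> complex) \<Rightarrow> complex"
  assumes "\<And>x y. \<alpha> (x + y) = \<alpha> x + \<alpha> y"
    and "inj \<alpha>"
    and "range_index \<alpha> > 1"
    and "(\<Inter>n. range (\<alpha> ^^ n)) = {0}"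
    and "normalized_haar \<mu>"
    and "m \<in> borel_measurable \<mu>"
    and "is_matrix_filter \<mu> \<alpha> m H"
    and "is_ruelle_operator \<mu> \<alpha> m H"
    and "emeasure \<mu> {\<omega> \<in> dual_group. m \<omega> \<noteq> \<infinity>} > 0"
    and "L2_isometry \<mu> m (ruelle \<alpha> H)"
  shows "(\<not> pure_L2_isometry \<mu> m (ruelle \<alpha> H) \<longleftrightarrow>
            (\<exists>c f. L2_eigenvector \<mu> m (ruelle \<alpha> H) c f)) \<and>
         (\<not> pure_L2_isometry \<mu> m (ruelle \<alpha> H) \<longleftrightarrow>
            (\<exists>c f. cmod c = 1 \<and> L2_eigenvector \<mu> m (ruelle \<alpha> H) c f)) \<and>
         (\<forall>c f. L2_eigenvector \<mu> m (ruelle \<alpha> H) c f \<and> L2_norm \<mu> f = 1 \<longrightarrow>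
            (AE \<omega> in \<mu>. fibre_norm f \<omega> = 1))"
proof -
  interpret isometric_ruelle \<mu> \<alpha> m H
    by unfold_locales (fact assms)+
  have "\<not> pure_L2_isometry \<mu> m S \<longleftrightarrow> (\<exists>c f. L2_eigenvector \<mu> m S c f)"
    unfolding not_pure_iff
    using eigenvector_exists[OF _ _ assms(6,9)] eigenvector_has_all_preimages by blast
  \<comment> \<open>An eigenvalue of an isometry has modulus 1, so the two existence statements
    coincide.\<close>
  then show ?thesis
    using eigenvalue_norm unit_eigenvector_fibre_norm by blast
qed

end
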